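(* Let $d\ge2$, $\alpha\in[1,\infty)$, $1\le p<\infty$ and let $\mu$ be a nonnegative Radon measure on $\mathbb R^d$. The following three statements are equivalent: (i) For any $f\in\mathcal{BV}_{\mathcal H_\alpha}(\mathbb R^d)$, $$\Big(\int_{\mathbb R^d}|f|^p\,d\mu\Big)^{1/p}\lesssim\|f\|_{L^1}+\|\nabla_{\mathcal H_\alpha}f\|(\mathbb R^d).$$ (ii) For any Borel set $B\subseteq\mathbb R^d$, $$\mu(B)^{1/p}\lesssim|B|+P_{\mathcal H_\alpha}(B).$$ (iii) For any Borel set $B\subseteq\mathbb R^d$, $$\mu(B)^{1/p}\lesssim\mathrm{cap}(B,\mathcal{BV}_{\mathcal H_\alpha}(\mathbb R^d)).$$
   Context: $U\lesssim V$ means $U\le cV$ for a constant $c>0$ that does not depend on $f$ (in (i)) or on $B$ (in (ii), (iii)). $|B|$ is Lebesgue measure. For $i=1,\dots,d$ put $A^{\pm}_{i,\alpha}=\partial_{x_i}\pm\sqrt{\alpha-1}\,x_i|x|^{(\alpha-2)/2}$ (the second term acting by multiplication). For $\varphi=(\varphi_1,\dots,\varphi_{2d})\in C^1(\mathbb R^d;\mathbb R^{2d})$, $$\mathrm{div}_{\mathcal H_\alpha}\varphi=A^+_{d,\alpha}\varphi_1+\cdots+A^+_{1,\alpha}\varphi_d+A^-_{1,\alpha}\varphi_{d+1}+\cdots+A^-_{d,\alpha}\varphi_{2d}.$$ $\mathcal F(\mathbb R^d)$ is the class of $\varphi\in C^1_c(\mathbb R^d;\mathbb R^{2d})$ with $\sup_x(|\varphi_1(x)|^2+\cdots+|\varphi_{2d}(x)|^2)^{1/2}\le1$.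 The $\alpha$-Hermite variation of $f\in L^1(\mathbb R^d)$ is $\|\nabla_{\mathcal H_\alpha}f\|(\mathbb R^d)=\sup_{\varphi\in\mathcal F(\mathbb R^d)}\int f\,\mathrm{div}_{\mathcal H_\alpha}\varphi\,dx$; $\mathcal{BV}_{\mathcal H_\alpha}(\mathbb R^d)$ is the set of $f\in L^1(\mathbb R^d)$ for which it is finite. The $\alpha$-Hermite perimeter of a (measurable) set $E$ is $P_{\mathcal H_\alpha}(E)=\sup_{\varphi\in\mathcal F(\mathbb R^d)}\int_E\mathrm{div}_{\mathcal H_\alpha}\varphi\,dx$. For $E\subseteq\mathbb R^d$, $\mathcal A(E,\mathcal{BV}_{\mathcal H_\alpha}(\mathbb R^d))$ is the class of $f\in\mathcal{BV}_{\mathcal H_\alpha}(\mathbb R^d)$ with $0\le f\le1$ and $f=1$ in a neighborhood of $E$ (an open set containing $E$), and $$\mathrm{cap}(E,\mathcal{BV}_{\mathcal H_\alpha}(\mathbb R^d))=\inf_{f\in\mathcal A(E,\mathcal{BV}_{\mathcal H_\alpha}(\mathbb R^d))}\big\{\|f\|_{L^1}+\|\nabla_{\mathcal H_\alpha}f\|(\mathbb R^d)\big\}.$$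
   Formalization: It is additionally assumed that Lebesgue-null sets are μ-null: (i) on L¹ classes needs this and (ii) implies it; without it (iii) does not imply (ii), e.g. d=2, p=1, μ = length measure on a segment. *)

theory Defs
  imports "HOL-Analysis.Analysis"
begin

definition C1_map :: "('a::real_normed_vector \<Rightarrow> 'b::real_normed_vector) \<Rightarrow> bool" where
  "C1_map \<phi> \<longleftrightarrow>
    (\<exists>D :: 'a \<Rightarrow> ('a \<Rightarrow>\<^sub>L 'b).
      (\<forall>x. (\<phi> has_derivative blinfun_apply (D x)) (at x)) \<and> continuous_on UNIV D)"

definition partial :: "'d::finite \<Rightarrow> (real^'d \<Rightarrow> real) \<Rightarrow> real^'d \<Rightarrow> real" where
  "partial i u x = deriv (\<lambda>t. u (x + t *\<^sub>R axis i 1)) 0"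

text \<open>At \<open>x = 0\<close> with \<open>\<alpha> < 2\<close> the weight below has value 0 (since \<open>x $ i = 0\<close>),
  which is its continuous extension.\<close>

definition A_plus :: "real \<Rightarrow> 'd::finite \<Rightarrow> (real^'d \<Rightarrow> real) \<Rightarrow> real^'d \<Rightarrow> real" where
  "A_plus \<alpha> i u x = partial i u x + sqrt (\<alpha> - 1) * (x $ i) * norm x powr ((\<alpha> - 2) / 2) * u x"

definition A_minus :: "real \<Rightarrow> 'd::finite \<Rightarrow> (real^'d \<Rightarrow> real) \<Rightarrow> real^'d \<Rightarrow> real" where
  "A_minus \<alpha> i u x = partial i u x - sqrt (\<alpha> - 1) * (x $ i) * norm x powr ((\<alpha> - 2) / 2) * u x"

text \<open>The \<open>2d\<close> components of a test field are indexed by the sum type \<open>'d + 'd\<close>. In the usual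
  numbering \<open>\<phi>\<^sub>1, \<dots>, \<phi>\<^sub>2\<^sub>d\<close>, \<open>Inl i\<close> is the component \<open>d + 1 - i\<close> (the one \<open>A_plus\<close> with index \<open>i\<close>
  acts on) and \<open>Inr i\<close> is the component \<open>d + i\<close>. The norm of \<open>real ^ ('d + 'd)\<close> is the Euclidean
  one and does not see the numbering.\<close>

definition div_H :: "real \<Rightarrow> (real^'d::finite \<Rightarrow> real^('d + 'd)) \<Rightarrow> real^'d \<Rightarrow> real" where
  "div_H \<alpha> \<phi> x =
    (\<Sum>i\<in>UNIV. A_plus \<alpha> i (\<lambda>y. \<phi> y $ Inl i) x) + (\<Sum>i\<in>UNIV. A_minus \<alpha> i (\<lambda>y. \<phi> y $ Inr i) x)"

definition test_fields :: "(real^'d::finite \<Rightarrow> real^('d + 'd)) set" where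
  "test_fields = {\<phi>. C1_map \<phi> \<and> compact (closure {x. \<phi> x \<noteq> 0}) \<and> (\<forall>x. norm (\<phi> x) \<le> 1)}"

text \<open>\<open>ennreal\<close> maps negative reals to 0. This does not change the suprema below, because
  \<open>\<phi> = 0\<close> is a test field and contributes the value 0.\<close>

definition variation_H :: "real \<Rightarrow> (real^'d::finite \<Rightarrow> real) \<Rightarrow> ennreal" where
  "variation_H \<alpha> f = (SUP \<phi>\<in>test_fields. ennreal (LINT x|lborel. f x * div_H \<alpha> \<phi> x))"

definition perimeter_H :: "real \<Rightarrow> (real^'d::finite) set \<Rightarrow> ennreal" where
  "perimeter_H \<alpha> E = (SUP \<phi>\<in>test_fields. ennreal (LINT x:E|lborel. div_H \<alpha> \<phi> x))"

text \<open>Elements of \<open>L\<^sup>1\<close> are represented by Borel functions.\<close>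

definition BV_H :: "real \<Rightarrow> (real^'d::finite \<Rightarrow> real) set" where
  "BV_H \<alpha> = {f. integrable lborel f \<and> variation_H \<alpha> f < \<infinity>}"

definition BV_H_norm :: "real \<Rightarrow> (real^'d::finite \<Rightarrow> real) \<Rightarrow> ennreal" where
  "BV_H_norm \<alpha> f = (\<integral>\<^sup>+x. ennreal \<bar>f x\<bar> \<partial>lborel) + variation_H \<alpha> f"

definition admissible_H :: "real \<Rightarrow> (real^'d::finite) set \<Rightarrow> (real^'d \<Rightarrow> real) set" where
  "admissible_H \<alpha> E =
    {f \<in> BV_H \<alpha>. (\<forall>x. 0 \<le> f x \<and> f x \<le> 1) \<and> (\<exists>U. open U \<and> E \<subseteq> U \<and> (\<forall>x\<in>U. f x = 1))}"

text \<open>The infimum over the empty class is \<open>\<infinity>\<close>.\<close>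

definition cap_H :: "real \<Rightarrow> (real^'d::finite) set \<Rightarrow> ennreal" where
  "cap_H \<alpha> E = (INF f\<in>admissible_H \<alpha> E. BV_H_norm \<alpha> f)"

text \<open>On a Euclidean space a Borel measure that is finite on compact sets is automatically
  inner and outer regular.\<close>

definition radon_measure :: "(real^'d::finite) measure \<Rightarrow> bool" where
  "radon_measure \<mu> \<longleftrightarrow> sets \<mu> = sets borel \<and> (\<forall>K. compact K \<longrightarrow> emeasure \<mu> K < \<infinity>)"

text \<open>Powers with positive real exponent on \<open>[0, \<infinity>]\<close>.\<close>

definition ennpowr :: "ennreal \<Rightarrow> real \<Rightarrow> ennreal" where
  "ennpowr x a = (if x = \<infinity> then \<infinity> else ennreal (enn2real x powr a))"

lemma ennpowr_eq_0_iff: "ennpowr x a = 0 \<longleftrightarrow> x = 0"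
  by (cases x) (auto simp: ennpowr_def)

text \<open>Elements of \<open>BV_H \<alpha>\<close> are only determined up to Lebesgue null sets. Integrating them against
  \<open>\<mu>\<close> is independent of the representative exactly when Lebesgue null sets are \<open>\<mu>\<close>-null. By the
  next two lemmas this property of \<open>\<mu>\<close> follows from the Sobolev type inequality for Borel
  representatives as well as from the isoperimetric type inequality.\<close>

lemma absolutely_continuous_if_sobolev:
  fixes \<mu> :: "(real^'d::finite) measure"
  assumes mu: "radon_measure \<mu>" and p: "1 \<le> p"
    and ineq: "\<And>f. f \<in> BV_H \<alpha> \<Longrightarrow>
      ennpowr (\<integral>\<^sup>+x. ennreal (\<bar>f x\<bar> powr p) \<partial>\<mu>) (1 / p) \<le> ennreal c * BV_H_norm \<alpha> f"
  shows "absolutely_continuous lborel \<mu>"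
  unfolding absolutely_continuous_def
proof
  fix N :: "(real^'d) set" assume N: "N \<in> null_sets lborel"
  define f where "f = indicat_real N"
  have ae: "AE x in lborel. f x = 0"
    using AE_not_in[OF N] by eventually_elim (auto simp: f_def)
  have 1: "(LINT x|lborel. f x * div_H \<alpha> \<phi> x) = 0" for \<phi> :: "real^'d \<Rightarrow> real^('d + 'd)"
    by (rule integral_eq_zero_AE) (use ae in eventually_elim, simp)
  have 2: "variation_H \<alpha> f = 0"
    by (simp add: variation_H_def 1 flip: bot_ennreal)
  have [measurable]: "N \<in> sets borel"
    using N by auto
  have "integrable lborel f"
    using N by (simp add: f_def null_sets_def)
  then have "f \<in> BV_H \<alpha>"
    by (simp add: BV_H_def 2)
  moreover have "(\<integral>\<^sup>+x. ennreal \<bar>f x\<bar> \<partial>lborel) = 0"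
    by (subst nn_integral_0_iff_AE) (use ae in \<open>auto simp: f_def\<close>)
  ultimately have "ennpowr (\<integral>\<^sup>+x. ennreal (\<bar>f x\<bar> powr p) \<partial>\<mu>) (1 / p) = 0"
    using ineq[of f] by (simp add: BV_H_norm_def 2)
  moreover have "(\<integral>\<^sup>+x. ennreal (\<bar>f x\<bar> powr p) \<partial>\<mu>) = (\<integral>\<^sup>+x. indicator N x \<partial>\<mu>)"
    by (intro nn_integral_cong) (auto simp: f_def indicator_def)
  moreover have "N \<in> sets \<mu>"
    using mu by (simp add: radon_measure_def)
  ultimately show "N \<in> null_sets \<mu>"
    by (simp add: ennpowr_eq_0_iff null_sets_def)
qed

lemma absolutely_continuous_if_isoperimetric:
  fixes \<mu> :: "(real^'d::finite) measure"
  assumes mu: "radon_measure \<mu>"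
    and ineq: "\<And>B. B \<in> sets borel \<Longrightarrow>
      ennpowr (emeasure \<mu> B) (1 / p) \<le> ennreal c * (emeasure lborel B + perimeter_H \<alpha> B)"
  shows "absolutely_continuous lborel \<mu>"
  unfolding absolutely_continuous_def
proof
  fix N :: "(real^'d) set" assume N: "N \<in> null_sets lborel"
  have "(LINT x:N|lborel. div_H \<alpha> \<phi> x) = 0" for \<phi> :: "real^'d \<Rightarrow> real^('d + 'd)"
    unfolding set_lebesgue_integral_def
    by (rule integral_eq_zero_AE) (use AE_not_in[OF N] in eventually_elim, simp)
  then have "perimeter_H \<alpha> N = 0"
    by (simp add: perimeter_H_def flip: bot_ennreal)
  then show "N \<in> null_sets \<mu>"
    using ineq[of N] N mu by (auto simp: null_sets_def ennpowr_eq_0_iff radon_measure_def)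
qed

end

theory Submission
  imports Defs
begin

text \<open>
  The proof rests on a description of the variation that makes sense for every \<open>f\<close> in \<open>L\<^sup>1\<close>. Write
  \<open>b\<^sub>i\<close> for the multiplier \<open>drift \<alpha> i\<close> in \<open>A\<^sup>\<plusminus>\<^sub>i = \<partial>\<^sub>i \<plusminus> b\<^sub>i\<close>. Adding and subtracting the two halves of a
  test field separates \<open>\<partial>\<^sub>i\<close> from \<open>b\<^sub>i\<close>, so that \<open>variation_H \<alpha> f\<close> is comparable, with constants that
  depend only on the dimension, to the Euclidean total variation of \<open>f\<close> plus the integral of
  \<open>weight \<alpha> * \<bar>f\<bar>\<close>, where \<open>weight \<alpha> x = sqrt (\<alpha> - 1) * norm x powr (\<alpha> / 2)\<close> is the length of the vector
  \<open>(b\<^sub>1, \<dots>, b\<^sub>d)\<close>. The Euclidean part is in turn captured by the \<open>L\<^sup>1\<close> norms \<open>shift_diff f v\<close> of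
  \<open>f (x + v) - f x\<close>. One has \<open>shift_diff f v \<le> norm v * variation_H \<alpha> f\<close>
  (\<open>shift_diff_le_variation\<close>), the weighted integral is at most \<open>d\<close> times the variation
  (\<open>integral_weight_le_variation\<close>), and conversely the lower limits of the difference quotients and
  the weighted integral bound the variation (\<open>variation_le_liminf_shift_diff\<close>).

  Both nontrivial implications become statements about shifts and weights.

  From sets to functions, (ii) to (i): for fixed \<open>x\<close> exactly one of \<open>t < \<bar>f (x + v)\<bar>\<close> and
  \<open>t < \<bar>f x\<bar>\<close> holds for a set of \<open>t > 0\<close> of length \<open>\<bar>\<bar>f (x + v)\<bar> - \<bar>f x\<bar>\<bar> \<le> \<bar>f (x + v) - f x\<bar>\<close>.
  Fubini and Fatou then give the inequality half of the coarea formula up to a constant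
  (\<open>coarea_inequality\<close>). With \<open>E\<^sub>t = {\<bar>f\<bar> > t}\<close>, monotonicity of \<open>t \<mapsto> \<mu> E\<^sub>t\<close> bounds the \<open>L\<^sup>p\<close> norm
  of \<open>f\<close> by twice the integral of \<open>(\<mu> E\<^sub>t)\<^bsup>1/p\<^esup>\<close> (\<open>Lp_le_integral_distribution\<close>), and (ii) applies to
  each \<open>E\<^sub>t\<close>.

  From capacity to perimeter, (iii) to (ii): a Borel set \<open>B\<close> of finite measure and perimeter may have
  infinite capacity, for instance a dense null set, since admissible functions are \<open>1\<close> on an open
  set. But averages \<open>g\<close> of the indicator of \<open>B\<close> against a continuous kernel of small support are
  continuous; averaging does not increase \<open>shift_diff\<close>, and the weighted integral of \<open>g\<close> is at most a
  constant times \<open>\<bar>B\<bar>\<close> plus the weighted integral of the indicator. Hence \<open>min 1 (2 * g)\<close> is admissible for the open set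
  \<open>{g > 1/2}\<close>, whose capacity is at most a constant times \<open>\<bar>B\<bar> + P(B)\<close>
  (\<open>ex_continuous_capacity_bound\<close>). As the support shrinks, \<open>g\<close> tends to the indicator in \<open>L\<^sup>1\<close>, so
  almost everywhere along a subsequence, and \<open>\<mu>\<close>-almost everywhere because \<open>\<mu>\<close> is absolutely
  continuous. Fatou's lemma transfers the bound on \<open>\<mu> {g > 1/2}\<close> to \<open>\<mu> B\<close>.

  The implications from (i) are tested on indicators and on admissible functions.
\<close>

section \<open>Continuously differentiable functions\<close>

lemma C1_mapI:
  fixes f :: "'a::euclidean_space \<Rightarrow> 'b::real_normed_vector"
  assumes "\<And>x. (f has_derivative f' x) (at x)" and "\<And>v. continuous_on UNIV (\<lambda>x. f' x v)"
  shows "C1_map f"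
  unfolding C1_map_def
proof (intro exI conjI allI)
  have app: "blinfun_apply (Blinfun (f' x)) = f' x" for x
    using assms(1) has_derivative_bounded_linear bounded_linear_Blinfun_apply by blast
  show "(f has_derivative blinfun_apply (Blinfun (f' x))) (at x)" for x
    by (simp add: app assms(1))
  show "continuous_on UNIV (\<lambda>x. Blinfun (f' x))"
    by (rule continuous_on_blinfun_componentwise) (simp add: app assms(2))
qed

lemma C1_mapE:
  assumes "C1_map f"
  obtains f' where "\<And>x. (f has_derivative f' x) (at x)" and "\<And>v. continuous_on UNIV (\<lambda>x. f' x v)"
proof -
  from assms obtain D where "\<And>x. (f has_derivative blinfun_apply (D x)) (at x)" "continuous_on UNIV D"
    unfolding C1_map_def by blast
  then show ?thesis
    by (intro that[of "\<lambda>x. blinfun_apply (D x)"]) (auto intro!: continuous_intros)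
qed

lemma C1_map_continuous:
  assumes "C1_map f" shows "continuous_on UNIV f"
  using assms unfolding C1_map_def
  by (meson continuous_at_imp_continuous_on has_derivative_continuous)

lemma C1_map_const: "C1_map (\<lambda>x::'a::euclidean_space. c)"
  by (rule C1_mapI[where f' = "\<lambda>_ _. 0"]) auto

lemma C1_map_linear:
  fixes f :: "'a::euclidean_space \<Rightarrow> 'b::real_normed_vector"
  assumes "bounded_linear f" shows "C1_map f"
  by (rule C1_mapI[where f' = "\<lambda>_. f"]) (auto simp: assms bounded_linear_imp_has_derivative)

lemma C1_map_add:
  fixes f g :: "'a::euclidean_space \<Rightarrow> 'b::real_normed_vector"
  assumes "C1_map f" "C1_map g" shows "C1_map (\<lambda>x. f x + g x)"
proof -
  from assms obtain f' g' where "\<And>x. (f has_derivative f' x) (at x)" "\<And>v. continuous_on UNIV (\<lambda>x. f' x v)"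
    "\<And>x. (g has_derivative g' x) (at x)" "\<And>v. continuous_on UNIV (\<lambda>x. g' x v)"
    by (metis C1_mapE)
  then show ?thesis
    by (intro C1_mapI[where f' = "\<lambda>x v. f' x v + g' x v"]) (auto intro!: continuous_intros has_derivative_add)
qed

lemma C1_map_mult:
  fixes f g :: "'a::euclidean_space \<Rightarrow> real"
  assumes "C1_map f" "C1_map g" shows "C1_map (\<lambda>x. f x * g x)"
proof -
  from assms obtain f' g' where "\<And>x. (f has_derivative f' x) (at x)" "\<And>v. continuous_on UNIV (\<lambda>x. f' x v)"
    "\<And>x. (g has_derivative g' x) (at x)" "\<And>v. continuous_on UNIV (\<lambda>x. g' x v)"
    by (metis C1_mapE)
  with C1_map_continuous[OF assms(1)] C1_map_continuous[OF assms(2)] show ?thesis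
    by (intro C1_mapI[where f' = "\<lambda>x v. f x * g' x v + f' x v * g x"])
       (auto intro!: continuous_intros has_derivative_mult)
qed

lemma C1_map_compose_real:
  fixes f :: "'a::euclidean_space \<Rightarrow> real"
  assumes "C1_map f" and h: "\<And>t. (h has_field_derivative h' t) (at t)" and "continuous_on UNIV h'"
  shows "C1_map (\<lambda>x. h (f x) :: real)"
proof -
  from assms(1) obtain f' where f': "\<And>x. (f has_derivative f' x) (at x)" "\<And>v. continuous_on UNIV (\<lambda>x. f' x v)"
    by (metis C1_mapE)
  show ?thesis
  proof (rule C1_mapI[where f' = "\<lambda>x v. f' x v * h' (f x)"])
    show "((\<lambda>x. h (f x)) has_derivative (\<lambda>v. f' x v * h' (f x))) (at x)" for x
      using DERIV_compose_FDERIV[OF h f'(1)] by simp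
    have "continuous_on UNIV (\<lambda>x. h' (f x))"
      using continuous_on_compose2[OF assms(3) C1_map_continuous[OF assms(1)]] by simp
    then show "continuous_on UNIV (\<lambda>x. f' x v * h' (f x))" for v
      using f'(2) by (intro continuous_intros)
  qed
qed

lemma has_derivative_translate:
  assumes "(f has_derivative D) (at (x + a))"
  shows "((\<lambda>x. f (x + a)) has_derivative D) (at x)"
proof -
  have "((\<lambda>x. x + a) has_derivative (\<lambda>v. v)) (at x)"
    by (auto intro!: derivative_eq_intros)
  from has_derivative_compose[OF this assms] show ?thesis .
qed

lemma C1_map_translate:
  fixes f :: "'a::euclidean_space \<Rightarrow> 'b::real_normed_vector"
  assumes "C1_map f" shows "C1_map (\<lambda>x. f (x + a))"
proof -
  from assms obtain f' where f': "\<And>x. (f has_derivative f' x) (at x)" "\<And>v. continuous_on UNIV (\<lambda>x. f' x v)"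
    by (metis C1_mapE)
  show ?thesis
  proof (rule C1_mapI[where f' = "\<lambda>x. f' (x + a)"])
    show "((\<lambda>x. f (x + a)) has_derivative f' (x + a)) (at x)" for x
      by (rule has_derivative_translate[OF f'(1)])
    show "continuous_on UNIV (\<lambda>x. f' (x + a) v)" for v
      by (rule continuous_on_compose2[OF f'(2)]) (auto intro!: continuous_intros)
  qed
qed

lemma C1_map_real_polynomial_function:
  fixes g :: "'a::euclidean_space \<Rightarrow> real"
  assumes "real_polynomial_function g" shows "C1_map g"
  using assms
  by induction (auto intro: C1_map_linear C1_map_const C1_map_add C1_map_mult)

text \<open>The square of the positive part is the simplest \<open>C\<^sup>1\<close> function that vanishes on a half line;
  the cut-off functions below are built from it.\<close>

lemma has_derivative_max_0_square:
  "((\<lambda>t::real. (max 0 t)\<^sup>2) has_field_derivative 2 * max 0 t) (at t)"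
proof -
  consider "t > 0" | "t < 0" | "t = 0" by linarith
  then show ?thesis
  proof cases
    case 1
    have "((\<lambda>t::real. t\<^sup>2) has_field_derivative 2 * max 0 t) (at t)"
      using 1 by (auto intro!: derivative_eq_intros)
    then show ?thesis
      by (rule has_field_derivative_transform_within_open[of _ _ _ "{0<..}"]) (use 1 in auto)
  next
    case 2
    have "((\<lambda>t::real. 0) has_field_derivative 2 * max 0 t) (at t)"
      using 2 by (auto intro!: derivative_eq_intros)
    then show ?thesis
      by (rule has_field_derivative_transform_within_open[of _ _ _ "{..<0}"]) (use 2 in auto)
  next
    case 3
    have "(\<lambda>h::real. (max 0 h)\<^sup>2 / h) \<midarrow>0\<rightarrow> 0"
      by (rule Lim_null_comparison[where g = "\<lambda>h. \<bar>h\<bar>"])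
         (auto simp: max_def power2_eq_square intro!: always_eventually tendsto_eq_intros)
    with 3 show ?thesis
      by (simp add: DERIV_def)
  qed
qed

definition C1c :: "('a::euclidean_space \<Rightarrow> real) set" where
  "C1c = {\<phi>. C1_map \<phi> \<and> bounded {x. \<phi> x \<noteq> 0}}"

lemma C1c_translate:
  assumes "\<phi> \<in> C1c" shows "(\<lambda>x. \<phi> (x + a)) \<in> C1c"
proof -
  have "{x. \<phi> (x + a) \<noteq> 0} = (\<lambda>x. - a + x) ` {x. \<phi> x \<noteq> 0}"
    by (force simp: image_iff intro: exI[of _ "_ + a"])
  then have "bounded {x. \<phi> (x + a) \<noteq> 0}"
    using assms bounded_translation[of "{x. \<phi> x \<noteq> 0}" "- a"] by (simp add: C1c_def)
  then show ?thesis
    using assms by (auto simp: C1c_def C1_map_translate)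
qed

lemma C1c_derivE:
  assumes "\<phi> \<in> C1c"
  obtains D K where "\<And>x. (\<phi> has_derivative D x) (at x)" "\<And>v. continuous_on UNIV (\<lambda>x. D x v)"
    "\<And>x v. \<bar>D x v\<bar> \<le> K * norm v" "0 \<le> K"
    "\<And>x v. \<bar>\<phi> (x + v) - \<phi> x\<bar> \<le> K * norm v"
proof -
  from assms obtain D where D: "\<And>x. (\<phi> has_derivative blinfun_apply (D x)) (at x)" "continuous_on UNIV D"
    unfolding C1c_def C1_map_def by blast
  from assms obtain R where R: "\<And>x. \<phi> x \<noteq> 0 \<Longrightarrow> x \<in> cball 0 R"
    by (auto simp: C1c_def bounded_iff)
  have D0: "D x = 0" if "x \<notin> cball 0 R" for x
  proof -
    have "((\<lambda>x. 0) has_derivative (\<lambda>v. 0)) (at x)" by simp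
    then have "(\<phi> has_derivative (\<lambda>v. 0)) (at x)"
      by (rule has_derivative_transform_within_open[of _ _ _ _ "- cball 0 R"]) (use that R in auto)
    then show ?thesis
      by (metis D(1) blinfun_eqI has_derivative_unique zero_blinfun.rep_eq)
  qed
  have "bounded (D ` cball 0 R)"
    by (intro compact_imp_bounded compact_continuous_image) (auto intro: continuous_on_subset[OF D(2)])
  then obtain K where K: "\<And>x. x \<in> cball 0 R \<Longrightarrow> norm (D x) \<le> K" "K > 0"
    unfolding bounded_pos by blast
  have nD: "norm (D x) \<le> K" for x
    using K D0[of x] by (cases "x \<in> cball 0 R") auto
  show ?thesis
  proof (rule that[of "\<lambda>x. blinfun_apply (D x)" K])
    show "continuous_on UNIV (\<lambda>x. blinfun_apply (D x) v)" for v
      using D(2) by (auto intro!: continuous_intros)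
    show *: "\<bar>blinfun_apply (D x) v\<bar> \<le> K * norm v" for x v
      using norm_blinfun[of "D x" v] mult_right_mono[OF nD[of x] norm_ge_zero[of v]] by simp
    show "\<bar>\<phi> (x + v) - \<phi> x\<bar> \<le> K * norm v" for x v
    proof -
      have "norm (\<phi> (x + v) - \<phi> x) \<le> K * norm ((x + v) - x)"
        by (rule differentiable_bound[of UNIV \<phi> "\<lambda>x. blinfun_apply (D x)"])
           (use D(1) nD in \<open>auto simp: norm_blinfun.rep_eq[symmetric]\<close>)
      then show ?thesis by simp
    qed
  qed (use D(1) K(2) in auto)
qed

lemma C1c_boundedE:
  assumes "\<phi> \<in> C1c"
  obtains R where "R > 0" "\<And>x. R < norm x \<Longrightarrow> \<phi> x = 0"
proof -
  from assms obtain R where "\<And>x. \<phi> x \<noteq> 0 \<Longrightarrow> norm x \<le> R" by (auto simp: C1c_def bounded_iff)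
  then show ?thesis using that[of "max 1 R"] by fastforce
qed

lemma borel_measurable_C1c:
  assumes "\<phi> \<in> C1c" shows "\<phi> \<in> borel_measurable borel"
  using assms C1_map_continuous by (auto simp: C1c_def intro: borel_measurable_continuous_onI)

section \<open>Duality with continuously differentiable test functions\<close>

text \<open>These functions increase to the indicator of the open ball of radius \<open>R\<close> as \<open>n \<rightarrow> \<infinity>\<close>. The rational function
  \<open>1 - 1 / (1 + u\<^sup>2) = u\<^sup>2 / (1 + u\<^sup>2)\<close> keeps the values in \<open>[0, 1)\<close>.\<close>

definition bump :: "real \<Rightarrow> nat \<Rightarrow> 'a::euclidean_space \<Rightarrow> real" where
  "bump R n x = 1 - inverse (1 + (max 0 (real n * (R\<^sup>2 - x \<bullet> x)))\<^sup>2)"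

lemma bump_bounds: "0 \<le> bump R n x" "bump R n x \<le> 1"
  by (auto simp: bump_def field_simps add_pos_nonneg)

lemma bump_outside:
  assumes "0 \<le> R" "R \<le> norm x" shows "bump R n x = 0"
proof -
  have "R\<^sup>2 \<le> x \<bullet> x" using assms by (simp add: power_mono flip: power2_norm_eq_inner)
  then show ?thesis by (simp add: bump_def mult_nonneg_nonpos)
qed

lemma C1_map_bump: "C1_map (bump R n :: 'a::euclidean_space \<Rightarrow> real)"
proof -
  let ?q = "\<lambda>t::real. (max 0 t)\<^sup>2"
  have pos: "1 + ?q t \<noteq> 0" for t
    by (smt (verit) zero_le_power2)
  have "real_polynomial_function (\<lambda>x::'a. x \<bullet> x)"
    by (subst euclidean_inner)
       (intro real_polynomial_function_sum real_polynomial_function.intros(1,4)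
         bounded_linear_inner_left finite_Basis)
  then have "real_polynomial_function (\<lambda>x::'a. real n * (R\<^sup>2 + (-1) * (x \<bullet> x)))"
    by (intro real_polynomial_function.intros(2,3,4))
  then have "C1_map (\<lambda>x::'a. real n * (R\<^sup>2 + (-1) * (x \<bullet> x)))"
    by (rule C1_map_real_polynomial_function)
  then have "C1_map (\<lambda>x::'a. 1 - inverse (1 + ?q (real n * (R\<^sup>2 + (-1) * (x \<bullet> x)))))"
  proof (rule C1_map_compose_real[where h' = "\<lambda>t. 2 * max 0 t * inverse ((1 + ?q t)\<^sup>2)"])
    show "((\<lambda>t. 1 - inverse (1 + ?q t)) has_field_derivative 2 * max 0 t * inverse ((1 + ?q t)\<^sup>2)) (at t)" for t
    proof -
      have "((\<lambda>t. 1 + ?q t) has_field_derivative 2 * max 0 t) (at t)"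
        using DERIV_add[OF DERIV_const has_derivative_max_0_square] by simp
      from DERIV_diff[OF DERIV_const DERIV_inverse'[OF this pos]]
      show ?thesis by (simp add: power2_eq_square mult_ac)
    qed
    show "continuous_on UNIV (\<lambda>t. 2 * max 0 t * inverse ((1 + ?q t)\<^sup>2))"
      using pos by (auto intro!: continuous_intros)
  qed
  then show ?thesis by (simp add: bump_def[abs_def])
qed

lemma bump_tendsto_1:
  assumes "norm x < R" shows "(\<lambda>n. bump R n x) \<longlonglongrightarrow> 1"
proof -
  have pos: "R\<^sup>2 - x \<bullet> x > 0"
    using assms by (simp add: power_strict_mono flip: power2_norm_eq_inner)
  have "filterlim (\<lambda>n. 1 + (real n * (R\<^sup>2 - x \<bullet> x))\<^sup>2) at_top sequentially"
    by (intro filterlim_tendsto_add_at_top[OF tendsto_const] filterlim_pow_at_top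
        filterlim_at_top_mult_tendsto_pos[OF tendsto_const pos] filterlim_real_sequentially) simp
  then have "(\<lambda>n. 1 - inverse (1 + (real n * (R\<^sup>2 - x \<bullet> x))\<^sup>2)) \<longlonglongrightarrow> 1 - 0"
    by (intro tendsto_diff tendsto_const tendsto_inverse_0_at_top)
  moreover have "max 0 (real n * (R\<^sup>2 - x \<bullet> x)) = real n * (R\<^sup>2 - x \<bullet> x)" for n
    using pos by simp
  ultimately show ?thesis by (simp add: bump_def)
qed

text \<open>A measurable function is an almost everywhere limit of continuous ones. Truncating these to \<open>[-1, 1]\<close>,
  replacing them by polynomials on the closed ball (Stone--Weierstrass) and multiplying by a bump
  makes them \<open>C\<^sup>1\<close> with compact support. The polynomials exceed \<open>1\<close> slightly, hence the factors
  \<open>s n\<close>.\<close>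

lemma sgn_approx_C1c:
  fixes g :: "'a::euclidean_space \<Rightarrow> real"
  assumes [measurable]: "g \<in> borel_measurable borel" and "0 \<le> R"
  obtains \<phi> where "\<And>n. \<phi> n \<in> C1c" "\<And>n x. \<bar>\<phi> n x\<bar> \<le> indicator (ball 0 R) x"
    "AE x in lborel. (\<lambda>n. \<phi> n x) \<longlonglongrightarrow> indicator (ball 0 R) x * sgn (g x)"
proof -
  have "(\<lambda>x. sgn (g x)) \<in> borel_measurable borel" by measurable
  then have "(\<lambda>x. sgn (g x)) \<in> borel_measurable lebesgue"
    by (intro measurable_completion) simp
  then have "(\<lambda>x. sgn (g x)) measurable_on UNIV"
    by (rule lebesgue_measurable_imp_measurable_on) simp
  then obtain N h where N: "negligible N" and hc: "\<And>n. continuous_on UNIV (h n)"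
    and hl: "\<And>x. x \<notin> N \<Longrightarrow> (\<lambda>n. h n x) \<longlonglongrightarrow> sgn (g x)"
    by (auto simp: measurable_on_def)
  define k where "k n x = max (-1) (min 1 (h n x))" for n x
  have kc: "continuous_on (cball 0 R) (k n)" for n
    unfolding k_def by (auto intro!: continuous_intros continuous_on_subset[OF hc])
  have "\<exists>q. real_polynomial_function q \<and> (\<forall>x\<in>cball 0 R. \<bar>k n x - q x\<bar> < 1 / Suc n)" for n
    by (rule Stone_Weierstrass_real_polynomial_function[OF compact_cball kc, of "1 / Suc n" n]) auto
  then obtain q where q: "\<And>n. real_polynomial_function (q n)"
    and kq: "\<And>n x. x \<in> cball 0 R \<Longrightarrow> \<bar>k n x - q n x\<bar> < 1 / Suc n"
    by metis
  \<comment> \<open>On the ball \<open>\<bar>q n\<bar> \<le> 1 + 1 / Suc n\<close>, so that \<open>s n * q n\<close> is bounded by \<open>1\<close>.\<close>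
  define s where "s n = 1 / (1 + 1 / real (Suc n))" for n
  define \<phi> where "\<phi> n x = bump R n x * (s n * q n x)" for n and x :: 'a
  have s: "0 < s n" "s n * (1 + 1 / Suc n) = 1" for n
    using add_pos_pos[of 1 "1 / real (Suc n)"] by (simp_all add: s_def)
  show ?thesis
  proof (rule that[of \<phi>])
    show "\<phi> n \<in> C1c" for n
    proof -
      have "C1_map (\<phi> n)"
        unfolding \<phi>_def
        by (intro C1_map_mult C1_map_bump C1_map_const C1_map_real_polynomial_function q)
      moreover have "{x. \<phi> n x \<noteq> 0} \<subseteq> ball 0 R"
        using bump_outside[OF \<open>0 \<le> R\<close>] by (force simp: \<phi>_def)
      ultimately show ?thesis
        unfolding C1c_def using bounded_subset bounded_ball by blast
    qed
    show "\<bar>\<phi> n x\<bar> \<le> indicator (ball 0 R) x" for n x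
    proof (cases "x \<in> ball 0 R")
      case True
      have "\<bar>k n x\<bar> \<le> 1" by (auto simp: k_def)
      then have "\<bar>q n x\<bar> \<le> 1 + 1 / Suc n"
        using kq[of x n] True by simp
      then have "s n * \<bar>q n x\<bar> \<le> s n * (1 + 1 / Suc n)"
        using s(1)[of n] by (intro mult_left_mono) auto
      then have "\<bar>s n * q n x\<bar> \<le> 1"
        using s[of n] by (simp only: abs_mult abs_of_pos)
      then have "\<bar>bump R n x\<bar> * \<bar>s n * q n x\<bar> \<le> 1"
        using bump_bounds[of R n x] by (intro mult_le_one) auto
      then show ?thesis using True by (simp add: \<phi>_def abs_mult mult.assoc)
    next
      case False
      then show ?thesis using bump_outside[OF \<open>0 \<le> R\<close>, of x n] by (simp add: \<phi>_def)
    qed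
    have conv: "(\<lambda>n. \<phi> n x) \<longlonglongrightarrow> indicator (ball 0 R) x * sgn (g x)" if "x \<notin> N" for x
    proof (cases "x \<in> ball 0 R")
      case True
      have "(\<lambda>n. k n x) \<longlonglongrightarrow> max (-1) (min 1 (sgn (g x)))"
        unfolding k_def by (intro tendsto_intros hl that)
      moreover have "max (-1) (min 1 (sgn (g x))) = sgn (g x)"
        by (auto simp: sgn_if)
      moreover have "(\<lambda>n. q n x - k n x) \<longlonglongrightarrow> 0"
        by (rule Lim_null_comparison[OF _ LIMSEQ_inverse_real_of_nat])
           (use True kq[of x] in \<open>auto intro!: always_eventually less_imp_le simp: abs_minus_commute inverse_eq_divide\<close>)
      ultimately have "(\<lambda>n. (q n x - k n x) + k n x) \<longlonglongrightarrow> 0 + sgn (g x)"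
        by (intro tendsto_add) auto
      then have 1: "(\<lambda>n. q n x) \<longlonglongrightarrow> sgn (g x)" by simp
      have "(\<lambda>n. 1 / (1 + inverse (real (Suc n)))) \<longlonglongrightarrow> 1 / (1 + 0)"
        by (intro tendsto_intros LIMSEQ_inverse_real_of_nat) auto
      then have 2: "s \<longlonglongrightarrow> 1"
        by (simp add: s_def[abs_def] inverse_eq_divide)
      have "(\<lambda>n. \<phi> n x) \<longlonglongrightarrow> 1 * (1 * sgn (g x))"
        unfolding \<phi>_def by (intro tendsto_mult 1 2 bump_tendsto_1) (use True in auto)
      then show ?thesis using True by simp
    next
      case False
      then show ?thesis using bump_outside[OF \<open>0 \<le> R\<close>, of x] by (simp add: \<phi>_def)
    qed
    have "AE x in lebesgue. x \<notin> N"
      using N by (simp add: AE_not_in negligible_iff_null_sets)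
    then have "AE x in lebesgue. (\<lambda>n. \<phi> n x) \<longlonglongrightarrow> indicator (ball 0 R) x * sgn (g x)"
      by eventually_elim (rule conv)
    then show "AE x in lborel. (\<lambda>n. \<phi> n x) \<longlonglongrightarrow> indicator (ball 0 R) x * sgn (g x)"
      by (simp add: AE_completion_iff)
  qed
qed

lemma nn_integral_le_by_balls:
  fixes g :: "'a::euclidean_space \<Rightarrow> ennreal"
  assumes [measurable]: "g \<in> borel_measurable borel"
    and "\<And>n::nat. (\<integral>\<^sup>+x. indicator (ball 0 n) x * g x \<partial>lborel) \<le> M"
  shows "(\<integral>\<^sup>+x. g x \<partial>lborel) \<le> M"
proof -
  have exhaust: "g x = (SUP n::nat. indicator (ball 0 n) x * g x)" for x
  proof (rule antisym)
    obtain n :: nat where n: "norm x < n" using reals_Archimedean2 by blast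
    have "indicator (ball 0 n) x * g x \<le> (SUP n::nat. indicator (ball 0 n) x * g x)"
      by (rule SUP_upper) simp
    with n show "g x \<le> (SUP n::nat. indicator (ball 0 n) x * g x)"
      by simp
    show "(SUP n::nat. indicator (ball 0 n) x * g x) \<le> g x"
      by (rule SUP_least) (auto simp: indicator_def)
  qed
  have "(\<integral>\<^sup>+x. g x \<partial>lborel) = (\<integral>\<^sup>+x. (SUP n::nat. indicator (ball 0 n) x * g x) \<partial>lborel)"
    by (rule nn_integral_cong, rule exhaust)
  also have "\<dots> = (SUP n::nat. \<integral>\<^sup>+x. indicator (ball 0 n) x * g x \<partial>lborel)"
    by (rule nn_integral_monotone_convergence_SUP)
       (auto simp: incseq_def le_fun_def indicator_def)
  finally show ?thesis using assms(2) by (simp add: SUP_least)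
qed

text \<open>The \<open>L\<^sup>1\<close> norm is a supremum over \<open>C\<^sup>1\<close> test functions of compact support: test against
  approximations of \<open>sgn g\<close> on a ball and let the ball grow. Only local integrability of \<open>g\<close> is
  assumed, since \<open>drift \<alpha> i * f\<close> is not known to be integrable beforehand.\<close>

lemma L1_duality_C1c:
  fixes g :: "'a::euclidean_space \<Rightarrow> real"
  assumes [measurable]: "g \<in> borel_measurable borel"
    and int: "\<And>R. integrable lborel (\<lambda>x. indicator (ball 0 R) x * g x)"
    and le: "\<And>\<phi>. \<phi> \<in> C1c \<Longrightarrow> (\<And>x. \<bar>\<phi> x\<bar> \<le> 1) \<Longrightarrow> (LINT x|lborel. g x * \<phi> x) \<le> M"
  shows "(\<integral>\<^sup>+x. ennreal \<bar>g x\<bar> \<partial>lborel) \<le> ennreal M"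
proof (rule nn_integral_le_by_balls)
  fix n :: nat
  obtain \<phi> where \<phi>: "\<And>k. \<phi> k \<in> C1c" "\<And>k x. \<bar>\<phi> k x\<bar> \<le> indicator (ball 0 n) x"
    "AE x in lborel. (\<lambda>k. \<phi> k x) \<longlonglongrightarrow> indicator (ball 0 n) x * sgn (g x)"
    using sgn_approx_C1c[OF assms(1), of n] by auto
  have [measurable]: "\<phi> k \<in> borel_measurable borel" for k
    using \<phi>(1) by (rule borel_measurable_C1c)
  have "(\<lambda>k. LINT x|lborel. g x * \<phi> k x) \<longlonglongrightarrow> (LINT x|lborel. \<bar>indicator (ball 0 n) x * g x\<bar>)"
  proof (rule integral_dominated_convergence)
    show "integrable lborel (\<lambda>x. \<bar>indicator (ball 0 n) x * g x\<bar>)"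
      using int by (intro integrable_abs)
    then show "(\<lambda>x. \<bar>indicator (ball 0 n) x * g x\<bar>) \<in> borel_measurable lborel"
      by (rule borel_measurable_integrable)
    show "AE x in lborel. (\<lambda>k. g x * \<phi> k x) \<longlonglongrightarrow> \<bar>indicator (ball 0 n) x * g x\<bar>"
      using \<phi>(3)
    proof eventually_elim
      case (elim x)
      have "g x * (indicator (ball 0 n) x * sgn (g x)) = \<bar>indicator (ball 0 n) x * g x\<bar>"
        by (auto simp: sgn_if indicator_def)
      then show ?case using tendsto_mult[OF tendsto_const elim, of "g x"] by simp
    qed
    show "AE x in lborel. norm (g x * \<phi> k x) \<le> \<bar>indicator (ball 0 n) x * g x\<bar>" for k
      using mult_left_mono[OF \<phi>(2), of "\<bar>g _\<bar>"] by (simp add: abs_mult mult.commute)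
  qed simp_all
  moreover have "(LINT x|lborel. g x * \<phi> k x) \<le> M" for k
    by (rule le[OF \<phi>(1)]) (rule order_trans[OF \<phi>(2)], simp add: indicator_def)
  ultimately have "(LINT x|lborel. \<bar>indicator (ball 0 n) x * g x\<bar>) \<le> M"
    by (meson LIMSEQ_le_const2)
  moreover have "(\<integral>\<^sup>+x. ennreal \<bar>indicator (ball 0 n) x * g x\<bar> \<partial>lborel)
      = ennreal (LINT x|lborel. \<bar>indicator (ball 0 n) x * g x\<bar>)"
    using int by (intro nn_integral_eq_integral integrable_abs AE_I2 abs_ge_zero)
  moreover have "ennreal \<bar>indicator (ball 0 n) x * g x\<bar> = indicator (ball 0 n) x * ennreal \<bar>g x\<bar>" for x
    by (auto simp: indicator_def)
  ultimately show "(\<integral>\<^sup>+x. indicator (ball 0 n) x * ennreal \<bar>g x\<bar> \<partial>lborel) \<le> ennreal M"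
    by (simp add: ennreal_leI)
qed simp

section \<open>The drift and its weight\<close>

text \<open>The multipliers in \<open>A_plus\<close> and \<open>A_minus\<close>; for \<open>\<alpha> \<ge> 1\<close> the Euclidean length of
  \<open>(drift \<alpha> i x)\<^sub>i\<close> is \<open>weight \<alpha> x\<close>.\<close>

definition drift :: "real \<Rightarrow> 'd::finite \<Rightarrow> real^'d \<Rightarrow> real" where
  "drift \<alpha> i x = sqrt (\<alpha> - 1) * (x $ i) * norm x powr ((\<alpha> - 2) / 2)"

definition weight :: "real \<Rightarrow> real^'d::finite \<Rightarrow> real" where
  "weight \<alpha> x = sqrt (\<alpha> - 1) * norm x powr (\<alpha> / 2)"

lemma drift_measurable [measurable]: "drift \<alpha> i \<in> borel_measurable borel"
proof -
  have "(\<lambda>x. x $ i) = (\<lambda>x::real^'a. x \<bullet> axis i 1)"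
    by (simp add: inner_axis fun_eq_iff)
  then have [measurable]: "(\<lambda>x::real^'a. x $ i) \<in> borel_measurable borel"
    by simp
  show ?thesis unfolding drift_def[abs_def] by measurable
qed

lemma weight_measurable [measurable]: "weight \<alpha> \<in> borel_measurable borel"
  unfolding weight_def[abs_def] by measurable

lemma weight_nonneg: "1 \<le> \<alpha> \<Longrightarrow> 0 \<le> weight \<alpha> x"
  by (simp add: weight_def)

lemma norm_mult_powr: "norm x * norm x powr ((\<alpha> - 2) / 2) = norm x powr (\<alpha> / 2)"
proof (cases "x = 0")
  case False
  then have "norm x * norm x powr ((\<alpha> - 2) / 2) = norm x powr (1 + (\<alpha> - 2) / 2)"
    by (simp add: powr_add)
  also have "1 + (\<alpha> - 2) / 2 = \<alpha> / 2" by (simp add: field_simps)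
  finally show ?thesis .
qed simp

lemma abs_drift_le_weight:
  assumes "1 \<le> \<alpha>" shows "\<bar>drift \<alpha> i x\<bar> \<le> weight \<alpha> x"
proof -
  have "\<bar>drift \<alpha> i x\<bar> = sqrt (\<alpha> - 1) * (\<bar>x $ i\<bar> * norm x powr ((\<alpha> - 2) / 2))"
    using assms by (simp add: drift_def abs_mult)
  also have "\<dots> \<le> sqrt (\<alpha> - 1) * (norm x * norm x powr ((\<alpha> - 2) / 2))"
    using assms by (intro mult_left_mono mult_right_mono component_le_norm_cart) auto
  finally show ?thesis by (simp add: weight_def norm_mult_powr)
qed

lemma weight_le_sum_drift:
  assumes "1 \<le> \<alpha>" shows "weight \<alpha> x \<le> (\<Sum>i\<in>UNIV. \<bar>drift \<alpha> i x\<bar>)"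
proof -
  have "weight \<alpha> x = norm x * (sqrt (\<alpha> - 1) * norm x powr ((\<alpha> - 2) / 2))"
    unfolding weight_def norm_mult_powr[of x \<alpha>, symmetric] by simp
  also have "\<dots> \<le> (\<Sum>i\<in>UNIV. \<bar>x $ i\<bar>) * (sqrt (\<alpha> - 1) * norm x powr ((\<alpha> - 2) / 2))"
    using assms by (intro mult_right_mono norm_le_l1_cart) auto
  also have "\<dots> = (\<Sum>i\<in>UNIV. \<bar>drift \<alpha> i x\<bar>)"
    using assms by (simp add: drift_def abs_mult sum_distrib_right sum_distrib_left mult_ac)
  finally show ?thesis .
qed

section \<open>Translations and difference quotients\<close>

definition shift_diff :: "('a::euclidean_space \<Rightarrow> real) \<Rightarrow> 'a \<Rightarrow> ennreal" where
  "shift_diff f v = (\<integral>\<^sup>+x. ennreal \<bar>f (x + v) - f x\<bar> \<partial>lborel)"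

lemma nn_integral_lborel_translate:
  fixes f :: "'a::euclidean_space \<Rightarrow> ennreal"
  assumes [measurable]: "f \<in> borel_measurable borel"
  shows "(\<integral>\<^sup>+x. f (x + v) \<partial>lborel) = (\<integral>\<^sup>+x. f x \<partial>lborel)"
proof -
  have "(\<integral>\<^sup>+x. f x \<partial>lborel) = (\<integral>\<^sup>+x. f x \<partial>distr lborel borel ((+) v))"
    by (simp add: lborel_distr_plus)
  also have "\<dots> = (\<integral>\<^sup>+x. f (x + v) \<partial>lborel)"
    by (subst nn_integral_distr) (auto simp: add.commute)
  finally show ?thesis by simp
qed

lemma integral_lborel_translate:
  fixes f :: "'a::euclidean_space \<Rightarrow> real"
  assumes [measurable]: "f \<in> borel_measurable borel"
  shows "(LINT x|lborel. f (x + v)) = (LINT x|lborel. f x)"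
proof -
  have "(LINT x|lborel. f x) = (LINT x|distr lborel borel ((+) v). f x)"
    by (simp add: lborel_distr_plus)
  also have "\<dots> = (LINT x|lborel. f (x + v))"
    by (subst integral_distr) (auto simp: add.commute)
  finally show ?thesis by simp
qed

lemma integrable_lborel_translate:
  fixes f :: "'a::euclidean_space \<Rightarrow> real"
  assumes "integrable lborel f"
  shows "integrable lborel (\<lambda>x. f (x + v))"
proof -
  have [measurable]: "f \<in> borel_measurable borel"
    using borel_measurable_integrable[OF assms] by simp
  have "integrable (distr lborel borel ((+) v)) f"
    using assms by (simp add: lborel_distr_plus)
  then have "integrable lborel (\<lambda>x. f (v + x))"
    by (subst (asm) integrable_distr_eq) auto
  then show ?thesis by (simp add: add.commute)
qed

lemma integrable_mult_bounded:
  fixes f g :: "'a \<Rightarrow> real"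
  assumes f: "integrable M f" and [measurable]: "g \<in> borel_measurable M" and "\<And>x. \<bar>g x\<bar> \<le> C"
  shows "integrable M (\<lambda>x. f x * g x)"
proof (rule Bochner_Integration.integrable_bound)
  show "integrable M (\<lambda>x. C * f x)" using f by simp
  have "0 \<le> C" using assms(3) abs_ge_zero order_trans by blast
  then show "AE x in M. norm (f x * g x) \<le> norm (C * f x)"
    using mult_left_mono[OF assms(3), of "\<bar>f _\<bar>"] by (simp add: abs_mult mult.commute)
qed (use borel_measurable_integrable[OF f] in measurable)

lemma has_derivative_imp_DERIV_line:
  assumes "(f has_derivative f') (at y)"
  shows "((\<lambda>t. f (y + t *\<^sub>R v) :: real) has_field_derivative f' v) (at 0)"
proof -
  have "((\<lambda>t. y + t *\<^sub>R v) has_derivative (\<lambda>t. t *\<^sub>R v)) (at 0)"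
    by (auto intro!: derivative_eq_intros)
  moreover have "(f has_derivative f') (at (y + 0 *\<^sub>R v))" using assms by simp
  ultimately have "((\<lambda>t. f (y + t *\<^sub>R v)) has_derivative (\<lambda>t. f' (t *\<^sub>R v))) (at 0)"
    by (rule has_derivative_compose)
  moreover have "f' (t *\<^sub>R v) = f' v * t" for t
    using linear_scale[OF has_derivative_linear[OF assms], of t v] by simp
  ultimately show ?thesis by (simp add: has_field_derivative_def)
qed

lemma C1c_derivative_props:
  assumes "\<phi> \<in> C1c" and "\<And>x. (\<phi> has_derivative D x) (at x)"
  obtains K where "(\<lambda>x. D x v) \<in> borel_measurable borel" "\<And>x. \<bar>D x v\<bar> \<le> K"
    "\<And>x t. \<bar>\<phi> (x + t *\<^sub>R v) - \<phi> x\<bar> \<le> K * \<bar>t\<bar>"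
proof -
  obtain D' K where D': "\<And>x. (\<phi> has_derivative D' x) (at x)" "\<And>v. continuous_on UNIV (\<lambda>x. D' x v)"
    "\<And>x v. \<bar>D' x v\<bar> \<le> K * norm v" "0 \<le> K" "\<And>x v. \<bar>\<phi> (x + v) - \<phi> x\<bar> \<le> K * norm v"
    using C1c_derivE[OF assms(1)] by metis
  have "D = D'" using has_derivative_unique[OF assms(2) D'(1)] by blast
  show ?thesis
  proof (rule that[of "K * norm v"])
    show "\<bar>\<phi> (x + t *\<^sub>R v) - \<phi> x\<bar> \<le> K * norm v * \<bar>t\<bar>" for x t
      using D'(5)[of x "t *\<^sub>R v"] by (simp add: mult_ac)
    show "(\<lambda>x. D x v) \<in> borel_measurable borel" "\<bar>D x v\<bar> \<le> K * norm v" for x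
      unfolding \<open>D = D'\<close> using D'(2,3) by (auto intro: borel_measurable_continuous_onI)
  qed
qed

lemma C1c_bound:
  assumes "\<phi> \<in> C1c"
  obtains C where "\<And>x. \<bar>\<phi> x\<bar> \<le> C"
proof -
  obtain R where R: "R > 0" "\<And>x. R < norm x \<Longrightarrow> \<phi> x = 0" using C1c_boundedE[OF assms] by metis
  have "continuous_on (cball 0 R) \<phi>"
    using assms C1_map_continuous continuous_on_subset by (force simp: C1c_def)
  then have "bounded (\<phi> ` cball 0 R)" by (intro compact_imp_bounded compact_continuous_image) auto
  then obtain C where C: "C > 0" "\<forall>x\<in>cball 0 R. norm (\<phi> x) \<le> C" unfolding bounded_pos by blast
  have "\<bar>\<phi> x\<bar> \<le> C" for x
    using C R(2)[of x] by (cases "norm x \<le> R") auto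
  then show ?thesis by (rule that)
qed

text \<open>Moving the test function instead of \<open>f\<close>: pairing \<open>f\<close> with translates of \<open>\<phi>\<close> is differentiable in the
  translation, by dominated convergence, because \<open>\<phi>\<close> is Lipschitz. Its derivatives are the pairings
  that enter the variation.\<close>

lemma DERIV_integral_translate:
  fixes f :: "'a::euclidean_space \<Rightarrow> real"
  assumes f: "integrable lborel f" and \<phi>: "\<phi> \<in> C1c" and D: "\<And>x. (\<phi> has_derivative D x) (at x)"
  shows "((\<lambda>s. LINT x|lborel. f x * \<phi> (x + s *\<^sub>R v)) has_field_derivative
           (LINT x|lborel. f x * D (x + s *\<^sub>R v) v)) (at s)"
proof -
  obtain K where Dm [measurable]: "(\<lambda>x. D x v) \<in> borel_measurable borel" and K: "\<And>x. \<bar>D x v\<bar> \<le> K"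
    "\<And>x t. \<bar>\<phi> (x + t *\<^sub>R v) - \<phi> x\<bar> \<le> K * \<bar>t\<bar>"
    using C1c_derivative_props[OF \<phi> D] by metis
  obtain C where C: "\<And>x. \<bar>\<phi> x\<bar> \<le> C" using C1c_bound[OF \<phi>] by metis
  have [measurable]: "\<phi> \<in> borel_measurable borel" by (rule borel_measurable_C1c[OF \<phi>])
  have [measurable]: "f \<in> borel_measurable borel" using borel_measurable_integrable[OF f] by simp
  have Dm' [measurable]: "(\<lambda>x. D (x + s *\<^sub>R v) v) \<in> borel_measurable borel"
    using measurable_compose[OF _ Dm, of "\<lambda>x. x + s *\<^sub>R v" borel] by simp
  let ?F = "\<lambda>s. LINT x|lborel. f x * \<phi> (x + s *\<^sub>R v)"
  have int: "integrable lborel (\<lambda>x. f x * \<phi> (x + s *\<^sub>R v))" for s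
    by (rule integrable_mult_bounded[OF f _ C]) simp
  show ?thesis
    unfolding DERIV_def tendsto_at_iff_sequentially
  proof (intro allI impI)
    fix X :: "nat \<Rightarrow> real" assume X: "\<forall>i. X i \<in> UNIV - {0}" "X \<longlonglongrightarrow> 0"
    have quot: "(?F (s + X n) - ?F s) / X n
        = (LINT x|lborel. f x * ((\<phi> ((x + s *\<^sub>R v) + X n *\<^sub>R v) - \<phi> (x + s *\<^sub>R v)) / X n))" for n
      using int[of "s + X n"] int[of s]
      by (simp add: algebra_simps diff_divide_distrib flip: Bochner_Integration.integral_diff Bochner_Integration.integral_divide_zero)
    have "(\<lambda>n. LINT x|lborel. f x * ((\<phi> ((x + s *\<^sub>R v) + X n *\<^sub>R v) - \<phi> (x + s *\<^sub>R v)) / X n))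
        \<longlonglongrightarrow> (LINT x|lborel. f x * D (x + s *\<^sub>R v) v)"
    proof (rule integral_dominated_convergence)
      show "integrable lborel (\<lambda>x. K * \<bar>f x\<bar>)" using f by simp
      show "AE x in lborel. norm (f x * ((\<phi> ((x + s *\<^sub>R v) + X n *\<^sub>R v) - \<phi> (x + s *\<^sub>R v)) / X n)) \<le> K * \<bar>f x\<bar>" for n
      proof (rule AE_I2)
        fix x
        have "\<bar>(\<phi> ((x + s *\<^sub>R v) + X n *\<^sub>R v) - \<phi> (x + s *\<^sub>R v)) / X n\<bar> \<le> K"
          using K(2)[of "x + s *\<^sub>R v" "X n"] X(1) by (simp add: abs_divide divide_le_eq)
        then show "norm (f x * ((\<phi> ((x + s *\<^sub>R v) + X n *\<^sub>R v) - \<phi> (x + s *\<^sub>R v)) / X n)) \<le> K * \<bar>f x\<bar>"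
          using mult_left_mono[of _ K "\<bar>f x\<bar>"] by (simp only: real_norm_def abs_mult mult.commute[of K]) 
      qed
      show "AE x in lborel. (\<lambda>n. f x * ((\<phi> ((x + s *\<^sub>R v) + X n *\<^sub>R v) - \<phi> (x + s *\<^sub>R v)) / X n))
              \<longlonglongrightarrow> f x * D (x + s *\<^sub>R v) v"
      proof (rule AE_I2)
        fix x
        have "((\<lambda>t. (\<phi> ((x + s *\<^sub>R v) + t *\<^sub>R v) - \<phi> (x + s *\<^sub>R v)) / t) \<longlongrightarrow> D (x + s *\<^sub>R v) v) (at 0)"
          using has_derivative_imp_DERIV_line[OF D, of "x + s *\<^sub>R v" v] by (simp add: DERIV_def)
        with X have "(\<lambda>n. (\<phi> ((x + s *\<^sub>R v) + X n *\<^sub>R v) - \<phi> (x + s *\<^sub>R v)) / X n) \<longlonglongrightarrow> D (x + s *\<^sub>R v) v"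
          unfolding tendsto_at_iff_sequentially comp_def by blast
        then show "(\<lambda>n. f x * ((\<phi> ((x + s *\<^sub>R v) + X n *\<^sub>R v) - \<phi> (x + s *\<^sub>R v)) / X n))
              \<longlonglongrightarrow> f x * D (x + s *\<^sub>R v) v"
          by (intro tendsto_intros)
      qed
    qed simp_all
    then show "((\<lambda>h. (?F (s + h) - ?F s) / h) \<circ> X) \<longlonglongrightarrow> (LINT x|lborel. f x * D (x + s *\<^sub>R v) v)"
      unfolding comp_def quot .
  qed
qed

lemma integral_shift_diff:
  fixes f :: "'a::euclidean_space \<Rightarrow> real"
  assumes f: "integrable lborel f" and \<phi>: "\<phi> \<in> C1c"
  shows "(LINT x|lborel. (f (x + v) - f x) * \<phi> x)
    = (LINT x|lborel. f x * \<phi> (x - v)) - (LINT x|lborel. f x * \<phi> x)"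
proof -
  obtain C where C: "\<And>x. \<bar>\<phi> x\<bar> \<le> C" using C1c_bound[OF \<phi>] by metis
  have [measurable]: "\<phi> \<in> borel_measurable borel" by (rule borel_measurable_C1c[OF \<phi>])
  have [measurable]: "f \<in> borel_measurable borel" using borel_measurable_integrable[OF f] by simp
  have 1: "integrable lborel (\<lambda>x. f (x + v) * \<phi> x)"
    by (rule integrable_mult_bounded[OF integrable_lborel_translate[OF f] _ C]) simp
  have 2: "integrable lborel (\<lambda>x. f x * \<phi> x)"
    by (rule integrable_mult_bounded[OF f _ C]) simp
  have "(LINT x|lborel. f (x + v) * \<phi> x) = (LINT x|lborel. f x * \<phi> (x - v))"
    using integral_lborel_translate[of "\<lambda>x. f x * \<phi> (x - v)" v] by simp
  then show ?thesis
    using 1 2 by (simp add: left_diff_distrib)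
qed

text \<open>By the preceding derivative, the pairing of \<open>f\<close> with a directional derivative is a limit of
  pairings of difference quotients of \<open>f\<close> with \<open>\<phi>\<close>, and \<open>\<bar>\<phi>\<bar> \<le> 1\<close>.\<close>

lemma abs_integral_derivative_le_liminf:
  fixes f :: "'a::euclidean_space \<Rightarrow> real"
  assumes f: "integrable lborel f" and \<phi>: "\<phi> \<in> C1c" "\<And>x. \<bar>\<phi> x\<bar> \<le> 1"
    and D: "\<And>x. (\<phi> has_derivative D x) (at x)"
  shows "ennreal \<bar>LINT x|lborel. f x * D x v\<bar>
    \<le> liminf (\<lambda>n. ennreal (Suc n) * shift_diff f ((1 / Suc n) *\<^sub>R v))"
proof -
  have [measurable]: "\<phi> \<in> borel_measurable borel" by (rule borel_measurable_C1c[OF \<phi>(1)])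
  have [measurable]: "f \<in> borel_measurable borel" using borel_measurable_integrable[OF f] by simp
  let ?F = "\<lambda>s. LINT x|lborel. f x * \<phi> (x + s *\<^sub>R (-v))"
  let ?L = "LINT x|lborel. f x * D x (-v)"
  have "(\<lambda>x. D x (-v)) = (\<lambda>x. - D x v)"
    using linear_neg[OF has_derivative_linear[OF D]] by auto
  then have L: "?L = - (LINT x|lborel. f x * D x v)"
    by (simp add: fun_eq_iff)
  have lim0: "filterlim (\<lambda>n. 1 / real (Suc n)) (at 0) sequentially"
    using LIMSEQ_inverse_real_of_nat by (auto simp: filterlim_at inverse_eq_divide)
  have "(?F has_field_derivative ?L) (at 0)"
    using DERIV_integral_translate[OF f \<phi>(1) D, of "-v" 0] by simp
  then have "(\<lambda>n. (?F (0 + 1 / Suc n) - ?F 0) / (1 / Suc n)) \<longlonglongrightarrow> ?L"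
    unfolding DERIV_def by (rule filterlim_compose[OF _ lim0])
  then have "(\<lambda>n. ennreal \<bar>(?F (0 + 1 / Suc n) - ?F 0) / (1 / Suc n)\<bar>) \<longlonglongrightarrow> ennreal \<bar>?L\<bar>"
    by (intro tendsto_ennrealI tendsto_rabs)
  then have "ennreal \<bar>?L\<bar> = liminf (\<lambda>n. ennreal \<bar>(?F (0 + 1 / Suc n) - ?F 0) / (1 / Suc n)\<bar>)"
    by (intro lim_imp_Liminf[symmetric]) auto
  also have "\<dots> \<le> liminf (\<lambda>n. ennreal (Suc n) * shift_diff f ((1 / Suc n) *\<^sub>R v))"
  proof (intro Liminf_mono always_eventually allI)
    fix n
    let ?w = "(1 / Suc n) *\<^sub>R v"
    have int: "integrable lborel (\<lambda>x. (f (x + ?w) - f x) * \<phi> x)"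
      by (rule integrable_mult_bounded[OF _ _ \<phi>(2)])
         (use integrable_lborel_translate[OF f] f in auto)
    have "?F (0 + 1 / Suc n) - ?F 0 = (LINT x|lborel. (f (x + ?w) - f x) * \<phi> x)"
      using integral_shift_diff[OF f \<phi>(1), of ?w] by simp
    moreover have "ennreal \<bar>LINT x|lborel. (f (x + ?w) - f x) * \<phi> x\<bar> \<le> shift_diff f ?w"
    proof -
      have "ennreal \<bar>LINT x|lborel. (f (x + ?w) - f x) * \<phi> x\<bar>
          \<le> (\<integral>\<^sup>+x. ennreal \<bar>(f (x + ?w) - f x) * \<phi> x\<bar> \<partial>lborel)"
        using integral_norm_bound_ennreal[OF int] by simp
      also have "\<dots> \<le> shift_diff f ?w"
        unfolding shift_diff_def
        by (intro nn_integral_mono ennreal_leI) (simp add: abs_mult mult_left_le \<phi>(2))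
      finally show ?thesis .
    qed
    ultimately have "ennreal \<bar>?F (0 + 1 / Suc n) - ?F 0\<bar> \<le> shift_diff f ?w" by simp
    then have "ennreal (Suc n) * ennreal \<bar>?F (0 + 1 / Suc n) - ?F 0\<bar> \<le> ennreal (Suc n) * shift_diff f ?w"
      by (rule mult_left_mono) simp
    moreover have "\<bar>a / (1 / Suc n)\<bar> = real (Suc n) * \<bar>a\<bar>" for a :: real
      by (simp add: abs_mult)
    ultimately show "ennreal \<bar>(?F (0 + 1 / Suc n) - ?F 0) / (1 / Suc n)\<bar> \<le> ennreal (Suc n) * shift_diff f ?w"
      by (simp only: ennreal_mult[OF of_nat_0_le_iff abs_ge_zero])
  qed
  finally show ?thesis using L by simp
qed

section \<open>The variation in terms of shifts and weighted integrals\<close>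

text \<open>A constant \<open>2d\<close>-vector whose two halves are given: equal halves select the derivatives in
  \<open>div_H\<close>, opposite halves select the drift.\<close>

definition join_fields :: "real^'d \<Rightarrow> real^'d \<Rightarrow> real^('d::finite + 'd)" where
  "join_fields a b = (\<chi> k. case k of Inl i \<Rightarrow> a $ i | Inr i \<Rightarrow> b $ i)"

lemma norm_join_fields_le: "norm (join_fields a b) \<le> norm a + norm b"
proof -
  have "(\<Sum>k\<in>UNIV. (norm (join_fields a b $ k))\<^sup>2)
      = (\<Sum>i\<in>UNIV. (norm (a $ i))\<^sup>2) + (\<Sum>i\<in>UNIV. (norm (b $ i))\<^sup>2)"
    by (simp add: sum.Plus join_fields_def flip: UNIV_Plus_UNIV)
  then show ?thesis
    by (simp add: norm_vec_def L2_set_def sqrt_add_le_add_sqrt sum_nonneg)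
qed

lemma scaled_test_field:
  assumes "\<phi> \<in> C1c" "\<And>x. \<bar>\<phi> x\<bar> \<le> 1" "norm w \<le> 1"
  shows "(\<lambda>x. \<phi> x *\<^sub>R w) \<in> test_fields"
  unfolding test_fields_def
proof (intro CollectI conjI allI)
  from assms(1) have "C1_map \<phi>" by (simp add: C1c_def)
  then obtain D where D: "\<And>x. (\<phi> has_derivative D x) (at x)" "\<And>v. continuous_on UNIV (\<lambda>x. D x v)"
    by (metis C1_mapE)
  show "C1_map (\<lambda>x. \<phi> x *\<^sub>R w)"
    by (rule C1_mapI[where f' = "\<lambda>x v. D x v *\<^sub>R w"])
       (use D in \<open>auto intro!: derivative_eq_intros continuous_intros\<close>)
  have "{x. \<phi> x *\<^sub>R w \<noteq> 0} \<subseteq> {x. \<phi> x \<noteq> 0}" by auto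
  then show "compact (closure {x. \<phi> x *\<^sub>R w \<noteq> 0})"
    using assms(1) bounded_subset by (auto simp: compact_closure C1c_def)
  show "norm (\<phi> x *\<^sub>R w) \<le> 1" for x
    using assms(2)[of x] assms(3) by (simp add: mult_le_one)
qed

lemma partial_eq:
  assumes "(u has_derivative D) (at x)"
  shows "partial i u x = D (axis i 1)"
  unfolding partial_def by (rule DERIV_imp_deriv[OF has_derivative_imp_DERIV_line[OF assms]])

lemma has_derivative_vec_nth:
  assumes "(f has_derivative D) F"
  shows "((\<lambda>x. f x $ k) has_derivative (\<lambda>v. D v $ k)) F"
  using bounded_linear.has_derivative[OF bounded_linear_vec_nth assms] .

lemma div_H_eq:
  assumes "(\<phi> has_derivative D) (at x)"
  shows "div_H \<alpha> \<phi> x = (\<Sum>i\<in>UNIV. D (axis i 1) $ Inl i + drift \<alpha> i x * \<phi> x $ Inl i)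
    + (\<Sum>i\<in>UNIV. D (axis i 1) $ Inr i - drift \<alpha> i x * \<phi> x $ Inr i)"
  using partial_eq[OF has_derivative_vec_nth[OF assms]]
  by (simp add: div_H_def A_plus_def A_minus_def drift_def)

lemma integral_div_H_le_variation:
  assumes "\<phi> \<in> test_fields" "variation_H \<alpha> f < \<infinity>"
  shows "(LINT x|lborel. f x * div_H \<alpha> \<phi> x) \<le> enn2real (variation_H \<alpha> f)"
proof -
  have "ennreal (LINT x|lborel. f x * div_H \<alpha> \<phi> x) \<le> variation_H \<alpha> f"
    unfolding variation_H_def by (rule SUP_upper[OF assms(1)])
  also have "\<dots> = ennreal (enn2real (variation_H \<alpha> f))"
    using assms(2) by simp
  finally show ?thesis by (simp add: ennreal_le_iff)
qed

text \<open>The field \<open>\<phi> / (2 * norm v) * (v, v)\<close> is a test field, and its \<open>div_H\<close> is \<open>\<partial>\<^sub>v\<phi> / norm v\<close> because the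
  drift terms cancel.\<close>

lemma integral_derivative_le_variation:
  assumes fin: "variation_H \<alpha> f < \<infinity>" and \<phi>: "\<phi> \<in> C1c" "\<And>x. \<bar>\<phi> x\<bar> \<le> 1"
    and D: "\<And>x. (\<phi> has_derivative D x) (at x)"
  shows "(LINT x|lborel. f x * D x v) \<le> norm v * enn2real (variation_H \<alpha> f)"
proof (cases "v = 0")
  case True
  then have "D x v = 0" for x using linear_0[OF has_derivative_linear[OF D]] by simp
  then show ?thesis using True by simp
next
  case False
  define a where "a = (1 / (2 * norm v)) *\<^sub>R v"
  define w where "w = join_fields a a"
  have "norm w \<le> 1"
    using norm_join_fields_le[of a a] False by (simp add: a_def w_def)
  then have test: "(\<lambda>x. \<phi> x *\<^sub>R w) \<in> test_fields"
    by (rule scaled_test_field[OF \<phi>])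
  have "div_H \<alpha> (\<lambda>x. \<phi> x *\<^sub>R w) x = (1 / norm v) * D x v" for x
  proof -
    have "((\<lambda>x. \<phi> x *\<^sub>R w) has_derivative (\<lambda>v. D x v *\<^sub>R w)) (at x)"
      using D by (auto intro!: derivative_eq_intros)
    from div_H_eq[OF this, of \<alpha>]
    have "div_H \<alpha> (\<lambda>x. \<phi> x *\<^sub>R w) x = (\<Sum>i\<in>UNIV. 2 * (D x (axis i 1) * a $ i))"
      by (simp add: w_def join_fields_def algebra_simps flip: sum.distrib)
    also have "\<dots> = 2 * D x (\<Sum>i\<in>UNIV. a $ i *\<^sub>R axis i 1)"
      using has_derivative_linear[OF D, of x] by (simp add: linear_sum linear_scale sum_distrib_left mult_ac)
    also have "(\<Sum>i\<in>UNIV. a $ i *\<^sub>R axis i 1) = a"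
      by (simp add: vec_eq_iff axis_def if_distrib cong: if_cong)
    also have "D x a = (1 / (2 * norm v)) * D x v"
      using has_derivative_linear[OF D, of x] by (simp add: linear_scale a_def)
    finally show ?thesis by simp
  qed
  then have "(LINT x|lborel. f x * div_H \<alpha> (\<lambda>x. \<phi> x *\<^sub>R w) x) = (1 / norm v) * (LINT x|lborel. f x * D x v)"
    by (simp flip: Bochner_Integration.integral_mult_right_zero add: mult_ac)
  with integral_div_H_le_variation[OF test fin] show ?thesis
    using False by (simp add: field_simps)
qed

text \<open>By duality it suffices to pair \<open>f (x + v) - f x\<close> with \<open>\<phi>\<close>. This equals the increment over \<open>[0, 1]\<close>
  of \<open>s \<mapsto> \<integral> f x * \<phi> (x - s *\<^sub>R v)\<close>, so the mean value theorem expresses it through a directional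
  derivative of a translate of \<open>\<phi>\<close>, which is controlled by the variation.\<close>

lemma shift_diff_le_variation:
  fixes f :: "real^'d::finite \<Rightarrow> real"
  assumes f: "integrable lborel f"
  shows "shift_diff f v \<le> ennreal (norm v) * variation_H \<alpha> f"
proof (cases "variation_H \<alpha> f < \<infinity>")
  case True
  have [measurable]: "f \<in> borel_measurable borel" using borel_measurable_integrable[OF f] by simp
  have "shift_diff f v \<le> ennreal (norm v * enn2real (variation_H \<alpha> f))"
    unfolding shift_diff_def
  proof (rule L1_duality_C1c)
    have "integrable lborel (\<lambda>x. f (x + v) - f x)"
      using f integrable_lborel_translate[OF f] by simp
    from integrable_mult_bounded[OF this, where C=1]
    show "integrable lborel (\<lambda>x. indicator (ball 0 R) x * (f (x + v) - f x))" for R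
      by (simp add: mult.commute indicator_def)
    fix \<phi> :: "real^'d \<Rightarrow> real" assume \<phi>: "\<phi> \<in> C1c" "\<And>x. \<bar>\<phi> x\<bar> \<le> 1"
    obtain D where D: "\<And>x. (\<phi> has_derivative D x) (at x)"
      using C1c_derivE[OF \<phi>(1)] by metis
    let ?F = "\<lambda>s. LINT x|lborel. f x * \<phi> (x + s *\<^sub>R (-v))"
    have "\<And>s. 0 \<le> s \<Longrightarrow> s \<le> 1 \<Longrightarrow> (?F has_field_derivative (LINT x|lborel. f x * D (x + s *\<^sub>R (-v)) (-v))) (at s)"
      by (rule DERIV_integral_translate[OF f \<phi>(1) D])
    from MVT2[OF zero_less_one this] obtain z
      where z: "?F 1 - ?F 0 = (1 - 0) * (LINT x|lborel. f x * D (x + z *\<^sub>R (-v)) (-v))" by blast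
    have D': "((\<lambda>x. \<phi> (x + z *\<^sub>R (-v))) has_derivative D (x + z *\<^sub>R (-v))) (at x)" for x
      by (rule has_derivative_translate[OF D])
    have "(LINT x|lborel. (f (x + v) - f x) * \<phi> x) = ?F 1 - ?F 0"
      using integral_shift_diff[OF f \<phi>(1), of v] by simp
    also have "\<dots> = (LINT x|lborel. f x * D (x + z *\<^sub>R (-v)) (-v))" using z by simp
    also have "\<dots> \<le> norm (-v) * enn2real (variation_H \<alpha> f)"
      by (rule integral_derivative_le_variation[OF True C1c_translate[OF \<phi>(1)] \<phi>(2) D'])
    finally show "(LINT x|lborel. (f (x + v) - f x) * \<phi> x) \<le> norm v * enn2real (variation_H \<alpha> f)"
      by simp
  qed simp
  then show ?thesis using True by (simp add: ennreal_mult)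
next
  case False
  then have "variation_H \<alpha> f = top" by (simp add: not_less top_unique)
  then show ?thesis
    by (cases "v = 0") (auto simp: shift_diff_def ennreal_mult_top)
qed

lemma scaled_shift_diff_le_variation:
  fixes f :: "real^'d::finite \<Rightarrow> real"
  assumes "integrable lborel f"
  shows "ennreal (Suc n) * shift_diff f ((1 / Suc n) *\<^sub>R axis i 1) \<le> variation_H \<alpha> f"
proof -
  have "ennreal (Suc n) * shift_diff f ((1 / Suc n) *\<^sub>R axis i 1)
      \<le> ennreal (Suc n) * (ennreal (norm ((1 / Suc n) *\<^sub>R axis i 1 :: real^'d)) * variation_H \<alpha> f)"
    by (intro mult_left_mono shift_diff_le_variation assms) simp
  also have "\<dots> = ennreal (Suc n * (1 / Suc n)) * variation_H \<alpha> f"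
    by (subst ennreal_mult) (simp_all add: mult.assoc)
  finally show ?thesis by simp
qed

text \<open>The field \<open>\<phi> / 2 * (e\<^sub>i, - e\<^sub>i)\<close> is a test field whose \<open>div_H\<close> is \<open>drift \<alpha> i * \<phi>\<close>: the derivatives
  cancel. Duality concludes.\<close>

lemma integral_drift_le_variation:
  fixes f :: "real^'d::finite \<Rightarrow> real"
  assumes \<alpha>: "1 \<le> \<alpha>" and f: "integrable lborel f"
  shows "(\<integral>\<^sup>+x. ennreal \<bar>drift \<alpha> i x * f x\<bar> \<partial>lborel) \<le> variation_H \<alpha> f"
proof (cases "variation_H \<alpha> f < \<infinity>")
  case True
  have [measurable]: "f \<in> borel_measurable borel" using borel_measurable_integrable[OF f] by simp
  have "(\<integral>\<^sup>+x. ennreal \<bar>drift \<alpha> i x * f x\<bar> \<partial>lborel) \<le> ennreal (enn2real (variation_H \<alpha> f))"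
  proof (rule L1_duality_C1c)
    fix R
    have b: "\<bar>indicator (ball 0 R) x * drift \<alpha> i x\<bar> \<le> sqrt (\<alpha> - 1) * R powr (\<alpha> / 2)" for x
    proof (cases "x \<in> ball 0 R")
      case True
      then have "weight \<alpha> x \<le> sqrt (\<alpha> - 1) * R powr (\<alpha> / 2)"
        using \<alpha> by (auto simp: weight_def intro!: mult_left_mono powr_mono2)
      then show ?thesis using True abs_drift_le_weight[OF \<alpha>, of i x] by simp
    qed (use \<alpha> in simp)
    show "integrable lborel (\<lambda>x. indicator (ball 0 R) x * (drift \<alpha> i x * f x))"
    proof -
      have "(\<lambda>x. indicator (ball 0 R) x * drift \<alpha> i x) \<in> borel_measurable lborel"
        by (intro borel_measurable_times borel_measurable_indicator) auto
      from integrable_mult_bounded[OF f this b] show ?thesis by (simp add: mult_ac)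
    qed
  next
    fix \<phi> :: "real^'d \<Rightarrow> real" assume \<phi>: "\<phi> \<in> C1c" "\<And>x. \<bar>\<phi> x\<bar> \<le> 1"
    obtain D where D: "\<And>x. (\<phi> has_derivative D x) (at x)"
      using C1c_derivE[OF \<phi>(1)] by metis
    define a :: "real^'d" where "a = (1/2) *\<^sub>R axis i 1"
    define w where "w = join_fields a (- a)"
    have "norm w \<le> 1"
      using norm_join_fields_le[of a "-a"] by (simp add: a_def w_def)
    then have test: "(\<lambda>x. \<phi> x *\<^sub>R w) \<in> test_fields"
      by (rule scaled_test_field[OF \<phi>])
    have "div_H \<alpha> (\<lambda>x. \<phi> x *\<^sub>R w) x = drift \<alpha> i x * \<phi> x" for x
    proof -
      have "((\<lambda>x. \<phi> x *\<^sub>R w) has_derivative (\<lambda>v. D x v *\<^sub>R w)) (at x)"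
        using D by (auto intro!: derivative_eq_intros)
      from div_H_eq[OF this, of \<alpha>]
      have "div_H \<alpha> (\<lambda>x. \<phi> x *\<^sub>R w) x = (\<Sum>j\<in>UNIV. 2 * (drift \<alpha> j x * \<phi> x * a $ j))"
        by (simp add: w_def join_fields_def algebra_simps flip: sum.distrib)
      then show ?thesis by (simp add: a_def axis_def if_distrib cong: if_cong)
    qed
    then show "(LINT x|lborel. drift \<alpha> i x * f x * \<phi> x) \<le> enn2real (variation_H \<alpha> f)"
      using integral_div_H_le_variation[OF test True] by (simp add: mult_ac)
  qed simp
  then show ?thesis using True by simp
next
  case False
  then show ?thesis by (simp add: not_less top_unique)
qed

lemma integral_weight_le_variation:
  fixes f :: "real^'d::finite \<Rightarrow> real"
  assumes \<alpha>: "1 \<le> \<alpha>" and f: "integrable lborel f"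
  shows "(\<integral>\<^sup>+x. ennreal (weight \<alpha> x * \<bar>f x\<bar>) \<partial>lborel) \<le> of_nat CARD('d) * variation_H \<alpha> f"
proof -
  have [measurable]: "f \<in> borel_measurable borel" using borel_measurable_integrable[OF f] by simp
  have "weight \<alpha> x * \<bar>f x\<bar> \<le> (\<Sum>i\<in>UNIV. \<bar>drift \<alpha> i x * f x\<bar>)" for x
    using mult_right_mono[OF weight_le_sum_drift[OF \<alpha>, of x] abs_ge_zero[of "f x"]]
    by (simp add: abs_mult sum_distrib_right)
  then have "(\<integral>\<^sup>+x. ennreal (weight \<alpha> x * \<bar>f x\<bar>) \<partial>lborel)
      \<le> (\<integral>\<^sup>+x. (\<Sum>i\<in>UNIV. ennreal \<bar>drift \<alpha> i x * f x\<bar>) \<partial>lborel)"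
    by (intro nn_integral_mono) (simp add: ennreal_leI)
  also have "\<dots> = (\<Sum>i\<in>UNIV. \<integral>\<^sup>+x. ennreal \<bar>drift \<alpha> i x * f x\<bar> \<partial>lborel)"
    by (rule nn_integral_sum) simp
  also have "\<dots> \<le> (\<Sum>i\<in>(UNIV::'d set). variation_H \<alpha> f)"
    by (intro sum_mono integral_drift_le_variation assms)
  finally show ?thesis by simp
qed

text \<open>Expanding \<open>div_H\<close> for an arbitrary test field gives, for each coordinate, two pairings with
  \<open>\<partial>\<^sub>i\<close> of a component and two with the drift, each component being bounded by \<open>1\<close>. The lower limit is
  kept (rather than a supremum over shifts) because it survives integration over level sets by
  Fatou's lemma.\<close>

lemma variation_le_liminf_shift_diff:
  fixes f :: "real^'d::finite \<Rightarrow> real"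
  assumes \<alpha>: "1 \<le> \<alpha>" and f: "integrable lborel f"
  shows "variation_H \<alpha> f \<le> 2 * (\<Sum>i\<in>UNIV. liminf (\<lambda>n. ennreal (Suc n) * shift_diff f ((1 / Suc n) *\<^sub>R axis i 1)))
      + 2 * of_nat CARD('d) * (\<integral>\<^sup>+x. ennreal (weight \<alpha> x * \<bar>f x\<bar>) \<partial>lborel)"
    (is "_ \<le> 2 * (\<Sum>i\<in>UNIV. ?L i) + _ * ?W")
proof (cases "?W < \<infinity>")
  case False
  then have "?W = top" by (simp add: not_less top_unique)
  then show ?thesis by (simp add: ennreal_mult_top)
next
  case True
  have [measurable]: "f \<in> borel_measurable borel" using borel_measurable_integrable[OF f] by simp
  show ?thesis
    unfolding variation_H_def[of \<alpha> f]
  proof (rule SUP_least)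
    fix \<phi> :: "real^'d \<Rightarrow> real^('d + 'd)" assume \<phi>: "\<phi> \<in> test_fields"
    then have "C1_map \<phi>" by (simp add: test_fields_def)
    then obtain D where D: "\<And>x. (\<phi> has_derivative D x) (at x)" "\<And>v. continuous_on UNIV (\<lambda>x. D x v)"
      by (metis C1_mapE)
    note Dk = has_derivative_vec_nth[OF D(1)]
    have c: "(\<lambda>x. \<phi> x $ k) \<in> C1c" for k
    proof -
      have "C1_map (\<lambda>x. \<phi> x $ k)"
        by (rule C1_mapI[OF Dk]) (auto intro!: continuous_intros D(2))
      moreover have "{x. \<phi> x $ k \<noteq> 0} \<subseteq> {x. \<phi> x \<noteq> 0}" by auto
      ultimately show ?thesis
        using \<phi> bounded_subset by (auto simp: C1c_def test_fields_def)
    qed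
    have [measurable]: "(\<lambda>x. \<phi> x $ k) \<in> borel_measurable borel" for k
      by (rule borel_measurable_C1c[OF c])
    have b: "\<bar>\<phi> x $ k\<bar> \<le> 1" for x k
      using \<phi> component_le_norm_cart[of "\<phi> x" k] by (auto simp: test_fields_def intro: order_trans)
    define T where "T i k = (LINT x|lborel. f x * D x (axis i 1) $ k)" for i k
    define S where "S i k = (LINT x|lborel. drift \<alpha> i x * f x * \<phi> x $ k)" for i k
    have intT: "integrable lborel (\<lambda>x. f x * D x (axis i 1) $ k)" for i k
    proof -
      obtain K where "(\<lambda>x. D x (axis i 1) $ k) \<in> borel_measurable borel" "\<And>x. \<bar>D x (axis i 1) $ k\<bar> \<le> K"
        using C1c_derivative_props[OF c Dk] by metis
      then show ?thesis by (intro integrable_mult_bounded[OF f]) auto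
    qed
    have dW: "(\<integral>\<^sup>+x. ennreal \<bar>drift \<alpha> i x * f x\<bar> \<partial>lborel) \<le> ?W" for i
      using mult_right_mono[OF abs_drift_le_weight[OF \<alpha>], of "\<bar>f _\<bar>"]
      by (intro nn_integral_mono ennreal_leI) (simp add: abs_mult)
    have "integrable lborel (\<lambda>x. drift \<alpha> i x * f x)" for i
      using order_le_less_trans[OF dW True] by (intro integrableI_bounded) auto
    then have intS: "integrable lborel (\<lambda>x. drift \<alpha> i x * f x * \<phi> x $ k)" for i k
      by (rule integrable_mult_bounded[OF _ _ b]) simp
    have Tle: "ennreal \<bar>T i k\<bar> \<le> ?L i" for i k
      unfolding T_def by (rule abs_integral_derivative_le_liminf[OF f c b Dk])
    have Sle: "ennreal \<bar>S i k\<bar> \<le> ?W" for i k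
    proof -
      have "ennreal \<bar>S i k\<bar> \<le> (\<integral>\<^sup>+x. ennreal \<bar>drift \<alpha> i x * f x * \<phi> x $ k\<bar> \<partial>lborel)"
        using integral_norm_bound_ennreal[OF intS] by (simp add: S_def)
      also have "\<dots> \<le> (\<integral>\<^sup>+x. ennreal \<bar>drift \<alpha> i x * f x\<bar> \<partial>lborel)"
        by (intro nn_integral_mono ennreal_leI) (simp add: abs_mult mult_left_le b)
      finally show ?thesis using dW order_trans by blast
    qed
    have "f x * div_H \<alpha> \<phi> x = (\<Sum>i\<in>UNIV. f x * D x (axis i 1) $ Inl i + drift \<alpha> i x * f x * \<phi> x $ Inl i)
        + (\<Sum>i\<in>UNIV. f x * D x (axis i 1) $ Inr i - drift \<alpha> i x * f x * \<phi> x $ Inr i)" for x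
      unfolding div_H_eq[OF D(1)] by (simp add: distrib_left sum_distrib_left algebra_simps)
    then have "(LINT x|lborel. f x * div_H \<alpha> \<phi> x)
        = (\<Sum>i\<in>UNIV. T i (Inl i) + S i (Inl i)) + (\<Sum>i\<in>UNIV. T i (Inr i) - S i (Inr i))"
      using intT intS by (simp add: T_def S_def)
    also have "\<dots> \<le> (\<Sum>i\<in>UNIV. (\<bar>T i (Inl i)\<bar> + \<bar>S i (Inl i)\<bar>) + (\<bar>T i (Inr i)\<bar> + \<bar>S i (Inr i)\<bar>))"
      unfolding sum.distrib[symmetric] by (rule sum_mono) linarith
    finally have "ennreal (LINT x|lborel. f x * div_H \<alpha> \<phi> x)
        \<le> ennreal (\<Sum>i\<in>UNIV. (\<bar>T i (Inl i)\<bar> + \<bar>S i (Inl i)\<bar>) + (\<bar>T i (Inr i)\<bar> + \<bar>S i (Inr i)\<bar>))"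
      by (rule ennreal_leI)
    also have "\<dots> = (\<Sum>i\<in>UNIV. (ennreal \<bar>T i (Inl i)\<bar> + ennreal \<bar>S i (Inl i)\<bar>)
        + (ennreal \<bar>T i (Inr i)\<bar> + ennreal \<bar>S i (Inr i)\<bar>))"
      by (simp flip: sum_ennreal)
    also have "\<dots> \<le> (\<Sum>i\<in>UNIV. (?L i + ?W) + (?L i + ?W))"
      by (intro sum_mono add_mono Tle Sle)
    also have "\<dots> = 2 * (\<Sum>i\<in>UNIV. ?L i) + 2 * of_nat CARD('d) * ?W"
      by (simp add: sum.distrib mult_2 distrib_right add_ac)
    finally show "ennreal (LINT x|lborel. f x * div_H \<alpha> \<phi> x) \<le> 2 * (\<Sum>i\<in>UNIV. ?L i) + 2 * of_nat CARD('d) * ?W" .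
  qed
qed

lemma perimeter_H_eq: "perimeter_H \<alpha> E = variation_H \<alpha> (indicator E)"
  by (simp add: perimeter_H_def variation_H_def set_lebesgue_integral_def)

section \<open>Integration over level sets\<close>

lemma ennpowr_mono: "x \<le> y \<Longrightarrow> 0 \<le> a \<Longrightarrow> ennpowr x a \<le> ennpowr y a"
  by (cases x; cases y) (auto simp: ennpowr_def top_unique intro!: ennreal_leI powr_mono2)

lemma ennpowr_inverse_le_iff:
  assumes "0 < p" "0 \<le> K"
  shows "ennpowr x (1 / p) \<le> ennreal K \<longleftrightarrow> x \<le> ennreal (K powr p)"
proof (cases x)
  case (real r)
  have "r powr (1 / p) \<le> K \<longleftrightarrow> r \<le> K powr p"
  proof
    assume "r powr (1 / p) \<le> K"
    then have "(r powr (1 / p)) powr p \<le> K powr p" using assms by (intro powr_mono2) auto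
    then show "r \<le> K powr p" using assms real by (simp add: powr_powr)
  next
    assume "r \<le> K powr p"
    then have "r powr (1 / p) \<le> (K powr p) powr (1 / p)" using assms real by (intro powr_mono2) auto
    then show "r powr (1 / p) \<le> K" using assms by (simp add: powr_powr)
  qed
  then show ?thesis using real assms by (simp add: ennpowr_def ennreal_le_iff)
next
  case top
  then show ?thesis by (simp add: ennpowr_def top_unique)
qed

lemma sigma_finite_radon_measure:
  assumes "radon_measure \<mu>" shows "sigma_finite_measure \<mu>"
proof
  have sp: "space \<mu> = UNIV" using sets_eq_imp_space_eq[of \<mu> borel] assms by (simp add: radon_measure_def)
  have "(\<Union>n::nat. cball 0 (real n)) = (UNIV :: (real^'a) set)"
    using real_arch_simple by fastforce
  moreover have "emeasure \<mu> (cball 0 r) \<noteq> \<infinity>" for r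
    using assms compact_cball[of 0 r] unfolding radon_measure_def by (metis less_irrefl)
  ultimately show "\<exists>A. countable A \<and> A \<subseteq> sets \<mu> \<and> \<Union> A = space \<mu> \<and> (\<forall>a\<in>A. emeasure \<mu> a \<noteq> \<infinity>)"
    using assms sp by (intro exI[of _ "range (\<lambda>n::nat. cball 0 (real n))"]) (auto simp: radon_measure_def)
qed

text \<open>Up to the factor \<open>2 powr p\<close> it is enough to integrate over \<open>(a/2, a)\<close>, where \<open>t powr (p - 1)\<close> is at
  least \<open>(a/2) powr (p - 1)\<close>.\<close>

lemma powr_le_integral:
  assumes "1 \<le> p" "0 \<le> a"
  shows "ennreal (a powr p)
    \<le> ennreal (2 powr p) * (\<integral>\<^sup>+t. (if 0 < t \<and> t < a then ennreal (t powr (p - 1)) else 0) \<partial>lborel)"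
proof (cases "a = 0")
  case False
  then have a: "0 < a" using assms by simp
  have "ennreal ((a / 2) powr p) = ennreal ((a / 2) powr (p - 1)) * ennreal (a / 2)"
    using a powr_mult_base[of "a / 2" "p - 1"] by (simp add: mult.commute flip: ennreal_mult)
  also have "\<dots> = (\<integral>\<^sup>+t. ennreal ((a / 2) powr (p - 1)) * indicator {a/2<..<a} t \<partial>lborel)"
    using a by (subst nn_integral_cmult_indicator) auto
  also have "\<dots> \<le> (\<integral>\<^sup>+t. (if 0 < t \<and> t < a then ennreal (t powr (p - 1)) else 0) \<partial>lborel)"
    using a assms by (intro nn_integral_mono) (auto simp: indicator_def intro!: ennreal_leI powr_mono2)
  finally have "ennreal (2 powr p) * ennreal ((a / 2) powr p)
      \<le> ennreal (2 powr p) * (\<integral>\<^sup>+t. (if 0 < t \<and> t < a then ennreal (t powr (p - 1)) else 0) \<partial>lborel)"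
    by (rule mult_left_mono) simp
  moreover have "2 powr p * (a / 2) powr p = a powr p"
    using a by (simp flip: powr_mult)
  ultimately show ?thesis by (simp flip: ennreal_mult)
qed simp

text \<open>Let \<open>m t\<close> be the distribution function, \<open>k t = m t powr (1/p)\<close> and \<open>J\<close> the integral of \<open>k\<close>. Since \<open>k\<close> is
  decreasing, \<open>t * k t \<le> J\<close>, so \<open>t powr (p - 1) * m t = (t * k t) powr (p - 1) * k t\<close> is at most
  \<open>J powr (p - 1) * k t\<close>, and by Fubini the left side integrates to at least \<open>2 powr (- p)\<close> times the integral of \<open>f powr p\<close>.\<close>

lemma Lp_le_integral_distribution:
  fixes f :: "'a \<Rightarrow> real"
  assumes "sigma_finite_measure M" and [measurable]: "f \<in> borel_measurable M"
    and nn: "\<And>x. 0 \<le> f x" and p: "1 \<le> p"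
  shows "ennpowr (\<integral>\<^sup>+x. ennreal (f x powr p) \<partial>M) (1 / p)
    \<le> 2 * (\<integral>\<^sup>+t\<in>{0<..}. ennpowr (emeasure M {x \<in> space M. t < f x}) (1 / p) \<partial>lborel)"
    (is "_ \<le> 2 * ?I")
proof (cases ?I)
  case top
  then show ?thesis by (simp add: ennreal_mult_top)
next
  case (real J)
  interpret sigma_finite_measure M by fact
  interpret pair_sigma_finite M lborel ..
  define m where "m t = emeasure M {x \<in> space M. t < f x}" for t
  define k where "k t = ennpowr (m t) (1 / p)" for t
  have m_eq: "m t = (\<integral>\<^sup>+x. (if t < f x then 1 else 0) \<partial>M)" for t
  proof -
    have "m t = (\<integral>\<^sup>+x. indicator {x \<in> space M. t < f x} x \<partial>M)" by (simp add: m_def)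
    also have "\<dots> = (\<integral>\<^sup>+x. (if t < f x then 1 else 0) \<partial>M)"
      by (intro nn_integral_cong) (auto simp: indicator_def)
    finally show ?thesis .
  qed
  have [measurable]: "m \<in> borel_measurable borel"
    unfolding m_eq[abs_def] by measurable
  have [measurable]: "k \<in> borel_measurable borel"
    unfolding k_def[abs_def] ennpowr_def by measurable
  have I: "(\<integral>\<^sup>+t\<in>{0<..}. k t \<partial>lborel) = ennreal J"
    using real by (simp add: k_def m_def)
  have anti: "k t \<le> k s" if "s \<le> t" for s t
    unfolding k_def m_def using that p by (intro ennpowr_mono emeasure_mono) auto
  have tk: "ennreal t * k t \<le> ennreal J" if "0 < t" for t
  proof -
    have "ennreal t * k t = (\<integral>\<^sup>+s. k t * indicator {0<..t} s \<partial>lborel)"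
      using that by (subst nn_integral_cmult_indicator) (auto simp: mult.commute)
    also have "\<dots> \<le> (\<integral>\<^sup>+s\<in>{0<..}. k s \<partial>lborel)"
      by (intro nn_integral_mono) (auto simp: indicator_def anti)
    finally show ?thesis using I by simp
  qed
  have tm: "ennreal (t powr (p - 1)) * m t \<le> ennreal (J powr (p - 1)) * k t" if t: "0 < t" for t
  proof -
    have "m t \<noteq> top"
    proof
      assume "m t = top"
      then have "k t = top" by (simp add: k_def ennpowr_def)
      with tk[OF t] t show False by (simp add: ennreal_mult_top top_unique)
    qed
    then obtain r where r: "m t = ennreal r" "0 \<le> r" by (cases "m t") auto
    define q where "q = r powr (1 / p)"
    have k: "k t = ennreal q" using r by (simp add: k_def ennpowr_def q_def)
    have rq: "r = q powr p" using p r by (simp add: q_def powr_powr)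
    have "t powr (p - 1) * r \<le> J powr (p - 1) * q"
    proof (cases "q = 0")
      case True
      then show ?thesis using rq by simp
    next
      case False
      then have q: "0 < q" by (simp add: q_def)
      have "t * q \<le> J"
        using tk[OF t] t q \<open>0 \<le> J\<close> by (simp add: k ennreal_le_iff flip: ennreal_mult)
      then have "(t * q) powr (p - 1) * q \<le> J powr (p - 1) * q"
        using t q p by (intro mult_right_mono powr_mono2) auto
      moreover have "r = q powr (p - 1) * q"
        using q rq powr_mult_base[of q "p - 1"] by (simp add: mult.commute)
      ultimately show ?thesis using t q by (simp add: powr_mult mult.assoc)
    qed
    then show ?thesis
      using r k by (simp add: q_def ennreal_leI flip: ennreal_mult)
  qed
  have "(\<integral>\<^sup>+x. ennreal (f x powr p) \<partial>M)
      \<le> (\<integral>\<^sup>+x. ennreal (2 powr p) * (\<integral>\<^sup>+t. (if 0 < t \<and> t < f x then ennreal (t powr (p - 1)) else 0) \<partial>lborel) \<partial>M)"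
    by (intro nn_integral_mono powr_le_integral p nn)
  also have "\<dots> = ennreal (2 powr p) * (\<integral>\<^sup>+x. (\<integral>\<^sup>+t. (if 0 < t \<and> t < f x then ennreal (t powr (p - 1)) else 0) \<partial>lborel) \<partial>M)"
    by (rule nn_integral_cmult) measurable
  also have "(\<integral>\<^sup>+x. (\<integral>\<^sup>+t. (if 0 < t \<and> t < f x then ennreal (t powr (p - 1)) else 0) \<partial>lborel) \<partial>M)
      = (\<integral>\<^sup>+t. (\<integral>\<^sup>+x. (if 0 < t \<and> t < f x then ennreal (t powr (p - 1)) else 0) \<partial>M) \<partial>lborel)"
    by (rule Fubini'[symmetric]) measurable
  also have "\<dots> \<le> (\<integral>\<^sup>+t. ennreal (J powr (p - 1)) * (k t * indicator {0<..} t) \<partial>lborel)"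
  proof (rule nn_integral_mono)
    fix t :: real
    have "(\<integral>\<^sup>+x. (if 0 < t \<and> t < f x then ennreal (t powr (p - 1)) else 0) \<partial>M)
        = (\<integral>\<^sup>+x. ennreal (t powr (p - 1)) * indicator {0<..} t * (if t < f x then 1 else 0) \<partial>M)"
      by (intro nn_integral_cong) auto
    also have "\<dots> = ennreal (t powr (p - 1)) * indicator {0<..} t * m t"
      unfolding m_eq by (rule nn_integral_cmult) measurable
    finally show "(\<integral>\<^sup>+x. (if 0 < t \<and> t < f x then ennreal (t powr (p - 1)) else 0) \<partial>M)
        \<le> ennreal (J powr (p - 1)) * (k t * indicator {0<..} t)"
      using tm[of t] by (auto simp: indicator_def)
  qed
  also have "\<dots> = ennreal (J powr (p - 1)) * ennreal J"
    by (subst nn_integral_cmult) (simp_all add: I)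
  finally have "(\<integral>\<^sup>+x. ennreal (f x powr p) \<partial>M) \<le> ennreal (2 powr p) * (ennreal (J powr (p - 1)) * ennreal J)"
    by (simp add: mult_left_mono)
  also have "\<dots> = ennreal ((2 * J) powr p)"
    using \<open>0 \<le> J\<close> powr_mult_base[of J "p - 1"] by (simp add: powr_mult mult.commute flip: ennreal_mult)
  finally have "ennpowr (\<integral>\<^sup>+x. ennreal (f x powr p) \<partial>M) (1 / p) \<le> ennreal (2 * J)"
    using \<open>0 \<le> J\<close> p by (subst ennpowr_inverse_le_iff) auto
  then show ?thesis using real by (simp add: ennreal_mult)
qed

section \<open>The coarea inequality\<close>

text \<open>Levels are taken of \<open>\<bar>f\<bar>\<close>, so that integrals over \<open>t > 0\<close> cover functions of either sign.\<close>

definition superlevel :: "('a \<Rightarrow> real) \<Rightarrow> real \<Rightarrow> 'a set" where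
  "superlevel f t = {x. t < \<bar>f x\<bar>}"

lemma indicator_superlevel: "indicator (superlevel f t) x = (if t < \<bar>f x\<bar> then 1 else 0)"
  by (simp add: superlevel_def indicator_def)

lemma superlevel_sets:
  assumes [measurable]: "f \<in> borel_measurable borel"
  shows "superlevel f t \<in> sets borel"
  unfolding superlevel_def by measurable

lemma integral_superlevel_indicator_diff:
  assumes "0 \<le> a" "0 \<le> b"
  shows "(\<integral>\<^sup>+t\<in>{0<..}. ennreal \<bar>(if t < a then 1 else 0) - (if t < b then 1 else 0)\<bar> \<partial>lborel) \<le> ennreal \<bar>a - b\<bar>"
proof -
  have "(\<integral>\<^sup>+t\<in>{0<..}. ennreal \<bar>(if t < a then 1 else 0) - (if t < b then 1 else 0)\<bar> \<partial>lborel)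
      \<le> (\<integral>\<^sup>+t. indicator {min a b..max a b} t \<partial>lborel)"
    by (intro nn_integral_mono) (auto simp: indicator_def)
  also have "\<dots> = ennreal (max a b - min a b)" by simp
  also have "max a b - min a b = \<bar>a - b\<bar>" by auto
  finally show ?thesis .
qed

lemma shift_diff_superlevel_measurable:
  fixes f :: "'a::euclidean_space \<Rightarrow> real"
  assumes [measurable]: "f \<in> borel_measurable borel"
  shows "(\<lambda>t. shift_diff (indicator (superlevel f t)) v) \<in> borel_measurable borel"
  unfolding shift_diff_def indicator_superlevel by measurable

text \<open>For fixed \<open>x\<close> the indicators differ exactly for \<open>t\<close> between \<open>\<bar>f x\<bar>\<close> and \<open>\<bar>f (x + v)\<bar>\<close>; then Fubini.\<close>

lemma coarea_shift_diff:
  fixes f :: "'a::euclidean_space \<Rightarrow> real"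
  assumes [measurable]: "f \<in> borel_measurable borel"
  shows "(\<integral>\<^sup>+t\<in>{0<..}. shift_diff (indicator (superlevel f t)) v \<partial>lborel) \<le> shift_diff f v"
proof -
  have "(\<integral>\<^sup>+t\<in>{0<..}. shift_diff (indicator (superlevel f t)) v \<partial>lborel)
      = (\<integral>\<^sup>+t. (\<integral>\<^sup>+x. ennreal \<bar>(if t < \<bar>f (x + v)\<bar> then 1 else 0) - (if t < \<bar>f x\<bar> then 1 else 0)\<bar>
            * indicator {0<..} t \<partial>lborel) \<partial>lborel)"
    unfolding shift_diff_def indicator_superlevel by (subst nn_integral_multc) auto
  also have "\<dots> = (\<integral>\<^sup>+x. (\<integral>\<^sup>+t\<in>{0<..}. ennreal \<bar>(if t < \<bar>f (x + v)\<bar> then 1 else 0) - (if t < \<bar>f x\<bar> then 1 else 0)\<bar>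
             \<partial>lborel) \<partial>lborel)"
    by (rule lborel_pair.Fubini') measurable
  also have "\<dots> \<le> (\<integral>\<^sup>+x. ennreal \<bar>\<bar>f (x + v)\<bar> - \<bar>f x\<bar>\<bar> \<partial>lborel)"
    by (intro nn_integral_mono integral_superlevel_indicator_diff) auto
  also have "\<dots> \<le> shift_diff f v"
    unfolding shift_diff_def by (intro nn_integral_mono ennreal_leI) auto
  finally show ?thesis .
qed

text \<open>Layer cake: for \<open>w = 1\<close> this bounds the measures of the level sets, for the drift weight it bounds
  the zeroth order part of their perimeters.\<close>

lemma coarea_weight:
  fixes f :: "'a::euclidean_space \<Rightarrow> real"
  assumes [measurable]: "f \<in> borel_measurable borel" "w \<in> borel_measurable borel"
  shows "(\<integral>\<^sup>+t\<in>{0<..}. (\<integral>\<^sup>+x. w x * indicator (superlevel f t) x \<partial>lborel) \<partial>lborel)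
    \<le> (\<integral>\<^sup>+x. w x * ennreal \<bar>f x\<bar> \<partial>lborel)"
proof -
  have "(\<integral>\<^sup>+t\<in>{0<..}. (\<integral>\<^sup>+x. w x * indicator (superlevel f t) x \<partial>lborel) \<partial>lborel)
      = (\<integral>\<^sup>+t. (\<integral>\<^sup>+x. w x * ((if t < \<bar>f x\<bar> then 1 else 0) * indicator {0<..} t) \<partial>lborel) \<partial>lborel)"
    unfolding indicator_superlevel
    by (intro nn_integral_cong, subst nn_integral_multc[symmetric]) (auto simp: mult.assoc)
  also have "\<dots> = (\<integral>\<^sup>+x. (\<integral>\<^sup>+t. w x * ((if t < \<bar>f x\<bar> then 1 else 0) * indicator {0<..} t) \<partial>lborel) \<partial>lborel)"
    by (rule lborel_pair.Fubini') measurable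
  also have "\<dots> \<le> (\<integral>\<^sup>+x. w x * ennreal \<bar>f x\<bar> \<partial>lborel)"
  proof (intro nn_integral_mono)
    fix x
    have "(\<integral>\<^sup>+t. w x * ((if t < \<bar>f x\<bar> then 1 else 0) * indicator {0<..} t) \<partial>lborel)
        = w x * (\<integral>\<^sup>+t. (if t < \<bar>f x\<bar> then 1 else 0) * indicator {0<..} t \<partial>lborel)"
      by (rule nn_integral_cmult) measurable
    also have "(\<integral>\<^sup>+t. (if t < \<bar>f x\<bar> then 1 else 0) * indicator {0<..} t \<partial>lborel)
        = (\<integral>\<^sup>+t\<in>{0<..}. ennreal \<bar>(if t < \<bar>f x\<bar> then 1 else 0) - (if t < 0 then 1 else 0)\<bar> \<partial>lborel)"
      by (intro nn_integral_cong) (auto simp: indicator_def)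
    also have "\<dots> \<le> ennreal \<bar>\<bar>f x\<bar> - 0\<bar>"
      by (intro integral_superlevel_indicator_diff) auto
    finally show "(\<integral>\<^sup>+t. w x * ((if t < \<bar>f x\<bar> then 1 else 0) * indicator {0<..} t) \<partial>lborel) \<le> w x * ennreal \<bar>f x\<bar>"
      by (simp add: mult_left_mono)
  qed
  finally show ?thesis .
qed

lemma integrable_indicator_superlevel:
  fixes f :: "'a::euclidean_space \<Rightarrow> real"
  assumes f: "integrable lborel f" and "0 < t"
  shows "integrable lborel (indicator (superlevel f t) :: 'a \<Rightarrow> real)"
proof (rule Bochner_Integration.integrable_bound)
  have [measurable]: "f \<in> borel_measurable borel" using borel_measurable_integrable[OF f] by simp
  note superlevel_sets[measurable]
  show "integrable lborel (\<lambda>x. f x / t)" using f by simp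
  show "indicator (superlevel f t) \<in> borel_measurable lborel" by simp
  show "AE x in lborel. norm (indicator (superlevel f t) x :: real) \<le> norm (f x / t)"
    using \<open>0 < t\<close> by (auto simp: superlevel_def indicator_def field_simps)
qed

text \<open>The perimeter of a level set is dominated by a lower limit of its difference quotients plus its
  weighted measure. This majorant \<open>h\<close> is visibly measurable in \<open>t\<close>, whereas the perimeter is a supremum
  over uncountably many test fields. Fatou's lemma allows integrating the lower limits.\<close>

lemma coarea_inequality:
  fixes f :: "real^'d::finite \<Rightarrow> real"
  assumes \<alpha>: "1 \<le> \<alpha>" and f: "integrable lborel f"
  shows "\<exists>h\<in>borel_measurable borel.
    (\<forall>t>0. emeasure lborel (superlevel f t) + perimeter_H \<alpha> (superlevel f t) \<le> h t) \<and>
    (\<integral>\<^sup>+t\<in>{0<..}. h t \<partial>lborel) \<le> of_nat (1 + 2 * CARD('d) + 2 * CARD('d) * CARD('d)) * BV_H_norm \<alpha> f"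
proof -
  have [measurable]: "f \<in> borel_measurable borel" using borel_measurable_integrable[OF f] by simp
  note superlevel_sets[measurable] shift_diff_superlevel_measurable[measurable]
  let ?d = "of_nat CARD('d) :: ennreal"
  let ?V = "variation_H \<alpha> f"
  \<comment> \<open>The difference quotients, the measure and the weighted measure of the level sets.\<close>
  define q where "q i n t = ennreal (Suc n) * shift_diff (indicator (superlevel f t)) ((1 / Suc n) *\<^sub>R axis i 1)"
    for i :: 'd and n t
  define s where "s t = (\<integral>\<^sup>+x. 1 * indicator (superlevel f t) x \<partial>lborel)" for t
  define W where "W t = (\<integral>\<^sup>+x. ennreal (weight \<alpha> x) * indicator (superlevel f t) x \<partial>lborel)" for t
  have [measurable]: "q i n \<in> borel_measurable borel" for i n unfolding q_def by measurable
  have [measurable]: "s \<in> borel_measurable borel" unfolding s_def indicator_superlevel by measurable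
  have [measurable]: "W \<in> borel_measurable borel" unfolding W_def indicator_superlevel by measurable
  define h where "h t = s t + (2 * (\<Sum>i\<in>UNIV. liminf (\<lambda>n. q i n t)) + 2 * ?d * W t)" for t
  show ?thesis
  proof (intro bexI[of _ h] conjI allI impI)
    show [measurable]: "h \<in> borel_measurable borel" unfolding h_def by measurable
    fix t :: real assume "0 < t"
    have W: "(\<integral>\<^sup>+x. ennreal (weight \<alpha> x * \<bar>indicator (superlevel f t) x\<bar>) \<partial>lborel) = W t"
      unfolding W_def by (intro nn_integral_cong) (auto simp: indicator_def)
    have "emeasure lborel (superlevel f t) = s t" by (simp add: s_def)
    moreover have "perimeter_H \<alpha> (superlevel f t) \<le> 2 * (\<Sum>i\<in>UNIV. liminf (\<lambda>n. q i n t)) + 2 * ?d * W t"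
      using variation_le_liminf_shift_diff[OF \<alpha> integrable_indicator_superlevel[OF f \<open>0 < t\<close>]]
      unfolding W q_def perimeter_H_eq .
    ultimately show "emeasure lborel (superlevel f t) + perimeter_H \<alpha> (superlevel f t) \<le> h t"
      unfolding h_def by (intro add_mono) auto
  next
    have s: "(\<integral>\<^sup>+t\<in>{0<..}. s t \<partial>lborel) \<le> (\<integral>\<^sup>+x. ennreal \<bar>f x\<bar> \<partial>lborel)"
      using coarea_weight[of f "\<lambda>_. 1"] unfolding s_def by simp
    have W: "(\<integral>\<^sup>+t\<in>{0<..}. W t \<partial>lborel) \<le> ?d * ?V"
    proof -
      have "(\<integral>\<^sup>+t\<in>{0<..}. W t \<partial>lborel) \<le> (\<integral>\<^sup>+x. ennreal (weight \<alpha> x) * ennreal \<bar>f x\<bar> \<partial>lborel)"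
        unfolding W_def by (rule coarea_weight) auto
      also have "\<dots> = (\<integral>\<^sup>+x. ennreal (weight \<alpha> x * \<bar>f x\<bar>) \<partial>lborel)"
        by (simp add: ennreal_mult weight_nonneg[OF \<alpha>])
      also have "\<dots> \<le> ?d * ?V" by (rule integral_weight_le_variation[OF \<alpha> f])
      finally show ?thesis .
    qed
    have q: "(\<integral>\<^sup>+t\<in>{0<..}. liminf (\<lambda>n. q i n t) \<partial>lborel) \<le> ?V" for i
    proof -
      have "(\<integral>\<^sup>+t\<in>{0<..}. liminf (\<lambda>n. q i n t) \<partial>lborel) = (\<integral>\<^sup>+t. liminf (\<lambda>n. q i n t * indicator {0<..} t) \<partial>lborel)"
        by (intro nn_integral_cong) (auto simp: indicator_def Liminf_const)
      also have "\<dots> \<le> liminf (\<lambda>n. \<integral>\<^sup>+t\<in>{0<..}. q i n t \<partial>lborel)"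
        by (rule nn_integral_liminf) measurable
      also have "\<dots> \<le> liminf (\<lambda>n. ?V)"
      proof (intro Liminf_mono always_eventually allI)
        fix n
        have "(\<integral>\<^sup>+t\<in>{0<..}. q i n t \<partial>lborel)
            = ennreal (Suc n) * (\<integral>\<^sup>+t\<in>{0<..}. shift_diff (indicator (superlevel f t)) ((1 / Suc n) *\<^sub>R axis i 1) \<partial>lborel)"
          unfolding q_def mult.assoc by (rule nn_integral_cmult) measurable
        also have "\<dots> \<le> ennreal (Suc n) * shift_diff f ((1 / Suc n) *\<^sub>R axis i 1)"
          by (intro mult_left_mono coarea_shift_diff) auto
        also have "\<dots> \<le> ?V" by (rule scaled_shift_diff_le_variation[OF f])
        finally show "(\<integral>\<^sup>+t\<in>{0<..}. q i n t \<partial>lborel) \<le> ?V" .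
      qed
      finally show ?thesis by (simp add: Liminf_const)
    qed
    define l where "l i t = liminf (\<lambda>n. q i n t) * indicator {0<..} t" for i t
    have [measurable]: "l i \<in> borel_measurable borel" for i unfolding l_def by measurable
    have "(\<integral>\<^sup>+t\<in>{0<..}. h t \<partial>lborel) = (\<integral>\<^sup>+t. s t * indicator {0<..} t
        + (2 * (\<Sum>i\<in>UNIV. l i t) + 2 * ?d * (W t * indicator {0<..} t)) \<partial>lborel)"
      by (intro nn_integral_cong) (auto simp: h_def l_def indicator_def)
    also have "\<dots> = (\<integral>\<^sup>+t\<in>{0<..}. s t \<partial>lborel)
        + (2 * (\<Sum>i\<in>UNIV. \<integral>\<^sup>+t. l i t \<partial>lborel) + 2 * ?d * (\<integral>\<^sup>+t\<in>{0<..}. W t \<partial>lborel))"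
      by (simp add: nn_integral_add nn_integral_cmult nn_integral_sum)
    also have "\<dots> \<le> (\<integral>\<^sup>+x. ennreal \<bar>f x\<bar> \<partial>lborel) + (2 * (\<Sum>i\<in>(UNIV::'d set). ?V) + 2 * ?d * (?d * ?V))"
      by (intro add_mono mult_left_mono sum_mono s q[folded l_def] W) auto
    also have "\<dots> \<le> \<dots> + (?V + (2 * ?d + 2 * ?d * ?d) * (\<integral>\<^sup>+x. ennreal \<bar>f x\<bar> \<partial>lborel))"
      by simp
    also have "\<dots> = of_nat (1 + 2 * CARD('d) + 2 * CARD('d) * CARD('d)) * BV_H_norm \<alpha> f"
      by (simp add: BV_H_norm_def algebra_simps)
    finally show "(\<integral>\<^sup>+t\<in>{0<..}. h t \<partial>lborel) \<le> of_nat (1 + 2 * CARD('d) + 2 * CARD('d) * CARD('d)) * BV_H_norm \<alpha> f" .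
  qed
qed

section \<open>Mollification and capacity\<close>

lemma abs_integral_le_nn_integral:
  fixes f :: "'a \<Rightarrow> real"
  shows "ennreal \<bar>integral\<^sup>L M f\<bar> \<le> (\<integral>\<^sup>+x. ennreal \<bar>f x\<bar> \<partial>M)"
  using integral_norm_bound_ennreal[of M f] by (cases "integrable M f") (auto simp: not_integrable_integral_eq)

text \<open>Minkowski's integral inequality: the weighted \<open>L\<^sup>1\<close> norm of an average is at most the average of the
  weighted \<open>L\<^sup>1\<close> norms. Where the averaged function is not integrable, the Bochner integral is \<open>0\<close> by
  convention, so the bound persists.\<close>

lemma averaged_integral_le:
  fixes \<kappa> :: "'a::euclidean_space \<Rightarrow> real" and F :: "'a \<Rightarrow> 'a \<Rightarrow> real"
  assumes [measurable]: "\<kappa> \<in> borel_measurable borel" "w \<in> borel_measurable borel"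
    "case_prod F \<in> borel_measurable (lborel \<Otimes>\<^sub>M lborel)"
    and \<kappa>: "\<And>y. 0 \<le> \<kappa> y" "(\<integral>\<^sup>+y. ennreal (\<kappa> y) \<partial>lborel) = 1"
    and le: "\<And>y. \<kappa> y \<noteq> 0 \<Longrightarrow> (\<integral>\<^sup>+x. w x * ennreal \<bar>F x y\<bar> \<partial>lborel) \<le> A"
  shows "(\<integral>\<^sup>+x. w x * ennreal \<bar>LINT y|lborel. \<kappa> y * F x y\<bar> \<partial>lborel) \<le> A"
proof -
  have "(\<integral>\<^sup>+x. w x * ennreal \<bar>LINT y|lborel. \<kappa> y * F x y\<bar> \<partial>lborel)
      \<le> (\<integral>\<^sup>+x. w x * (\<integral>\<^sup>+y. ennreal \<bar>\<kappa> y * F x y\<bar> \<partial>lborel) \<partial>lborel)"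
    by (intro nn_integral_mono mult_left_mono abs_integral_le_nn_integral) auto
  also have "\<dots> = (\<integral>\<^sup>+x. (\<integral>\<^sup>+y. w x * ennreal \<bar>\<kappa> y * F x y\<bar> \<partial>lborel) \<partial>lborel)"
    by (intro nn_integral_cong nn_integral_cmult[symmetric]) measurable
  also have "\<dots> = (\<integral>\<^sup>+y. (\<integral>\<^sup>+x. w x * ennreal \<bar>\<kappa> y * F x y\<bar> \<partial>lborel) \<partial>lborel)"
    by (rule lborel_pair.Fubini'[symmetric]) measurable
  also have "\<dots> = (\<integral>\<^sup>+y. (\<integral>\<^sup>+x. ennreal (\<kappa> y) * (w x * ennreal \<bar>F x y\<bar>) \<partial>lborel) \<partial>lborel)"
    by (simp add: abs_mult \<kappa>(1) ennreal_mult mult_ac)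
  also have "\<dots> = (\<integral>\<^sup>+y. ennreal (\<kappa> y) * (\<integral>\<^sup>+x. w x * ennreal \<bar>F x y\<bar> \<partial>lborel) \<partial>lborel)"
    by (intro nn_integral_cong nn_integral_cmult) measurable
  also have "\<dots> \<le> (\<integral>\<^sup>+y. ennreal (\<kappa> y) * A \<partial>lborel)"
  proof (intro nn_integral_mono)
    show "ennreal (\<kappa> y) * (\<integral>\<^sup>+x. w x * ennreal \<bar>F x y\<bar> \<partial>lborel) \<le> ennreal (\<kappa> y) * A" for y
      using le[of y] by (cases "\<kappa> y = 0") (auto intro: mult_left_mono)
  qed
  also have "\<dots> = A" by (simp add: nn_integral_multc \<kappa>(2))
  finally show ?thesis .
qed

lemma ex_averaging_kernel:
  assumes "0 < r"
  obtains \<kappa> :: "'a::euclidean_space \<Rightarrow> real" and C where "continuous_on UNIV \<kappa>"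
    "\<And>y. 0 \<le> \<kappa> y" "\<And>y. \<kappa> y \<le> C" "\<And>y. \<kappa> y \<noteq> 0 \<Longrightarrow> norm y < r"
    "integrable lborel \<kappa>" "(\<integral>\<^sup>+y. ennreal (\<kappa> y) \<partial>lborel) = 1"
proof -
  define k :: "'a \<Rightarrow> real" where "k y = max 0 (r - norm y)" for y
  have c: "continuous_on UNIV k" unfolding k_def by (intro continuous_intros)
  have int: "integrable lborel k"
  proof (rule Bochner_Integration.integrable_bound)
    show "integrable lborel (\<lambda>y::'a. r * indicator (cball 0 r) y)"
      by (intro integrable_mult_right integrable_real_indicator) (use emeasure_bounded_finite[OF bounded_cball] in simp_all)
    show "k \<in> borel_measurable lborel" using borel_measurable_continuous_onI[OF c] by simp
    show "AE y in lborel. norm (k y) \<le> norm (r * indicator (cball 0 r) y)"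
      using \<open>0 < r\<close> by (auto simp: k_def indicator_def)
  qed
  define Z where "Z = (LINT y|lborel. k y)"
  have "0 < (LINT y|lborel. (r / 2) * indicator (ball (0::'a) (r / 2)) y)"
    using \<open>0 < r\<close> by (simp add: content_ball_pos)
  also have "\<dots> \<le> Z" unfolding Z_def
  proof (rule integral_mono)
    show "integrable lborel (\<lambda>y::'a. (r / 2) * indicator (ball 0 (r / 2)) y)"
      by (intro integrable_mult_right integrable_real_indicator) (use emeasure_bounded_finite[OF bounded_ball] in simp_all)
    show "(r / 2) * indicator (ball 0 (r / 2)) y \<le> k y" for y
      using \<open>0 < r\<close> by (auto simp: k_def indicator_def)
  qed (rule int)
  finally have Z: "0 < Z" .
  show ?thesis
  proof (rule that[of "\<lambda>y. k y / Z" "r / Z"])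
    show "continuous_on UNIV (\<lambda>y. k y / Z)" using c Z by (intro continuous_intros) auto
    show "0 \<le> k y / Z" for y using Z by (simp add: k_def)
    show "k y / Z \<le> r / Z" for y using Z \<open>0 < r\<close> by (simp add: k_def divide_right_mono)
    show "norm y < r" if "k y / Z \<noteq> 0" for y using that by (auto simp: k_def max_def split: if_splits)
    show "integrable lborel (\<lambda>y. k y / Z)" using int by simp
    then have "(\<integral>\<^sup>+y. ennreal (k y / Z) \<partial>lborel) = ennreal (LINT y|lborel. k y / Z)"
      using Z by (intro nn_integral_eq_integral) (auto simp: k_def)
    then show "(\<integral>\<^sup>+y. ennreal (k y / Z) \<partial>lborel) = 1" using Z by (simp add: Z_def)
  qed
qed

text \<open>Averaging against a continuous kernel. The three estimates are instances of Minkowski's inequality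
  for the averages of \<open>f (x + y)\<close>, of \<open>f (x + v + y) - f (x + y)\<close> and of \<open>f (x + y) - f x\<close>.
  Continuity comes from moving the translation to the kernel.\<close>

lemma ex_mollification:
  fixes f :: "'a::euclidean_space \<Rightarrow> real"
  assumes f: "integrable lborel f" and f01: "\<And>x. 0 \<le> f x" "\<And>x. f x \<le> 1" and r: "0 < r"
  obtains g where "continuous_on UNIV g" "\<And>x. 0 \<le> g x"
    "\<And>w A. w \<in> borel_measurable borel \<Longrightarrow>
      (\<And>y. norm y < r \<Longrightarrow> (\<integral>\<^sup>+x. w x * ennreal \<bar>f (x + y)\<bar> \<partial>lborel) \<le> A) \<Longrightarrow>
      (\<integral>\<^sup>+x. w x * ennreal \<bar>g x\<bar> \<partial>lborel) \<le> A"
    "\<And>v. shift_diff g v \<le> shift_diff f v"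
    "\<And>A. (\<And>y. norm y < r \<Longrightarrow> shift_diff f y \<le> A) \<Longrightarrow> (\<integral>\<^sup>+x. ennreal \<bar>g x - f x\<bar> \<partial>lborel) \<le> A"
proof -
  obtain \<kappa> :: "'a \<Rightarrow> real" and C where c: "continuous_on UNIV \<kappa>" and \<kappa>: "\<And>y. 0 \<le> \<kappa> y" "\<And>y. \<kappa> y \<le> C"
    "\<And>y. \<kappa> y \<noteq> 0 \<Longrightarrow> norm y < r" "integrable lborel \<kappa>" "(\<integral>\<^sup>+y. ennreal (\<kappa> y) \<partial>lborel) = 1"
    using ex_averaging_kernel[OF r] by metis
  have [measurable]: "f \<in> borel_measurable borel" using borel_measurable_integrable[OF f] by simp
  have [measurable]: "\<kappa> \<in> borel_measurable borel" by (rule borel_measurable_continuous_onI[OF c])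
  define g where "g x = (LINT y|lborel. \<kappa> y * f (x + y))" for x
  have int: "integrable lborel (\<lambda>y. \<kappa> y * f (x + y))" for x
    by (rule integrable_mult_bounded[OF \<kappa>(4), of _ 1]) (use f01 in auto)
  have int1: "(LINT y|lborel. \<kappa> y) = 1"
    using \<kappa>(1,4,5) by (simp add: nn_integral_eq_integral)
  show ?thesis
  proof (rule that[of g])
    show "0 \<le> g x" for x unfolding g_def using \<kappa>(1) f01(1) by (intro integral_nonneg_AE) auto
    have g': "g x = (LINT z|lborel. f z * \<kappa> (z - x))" for x
      using integral_lborel_translate[of "\<lambda>z. f z * \<kappa> (z - x)" x] by (simp add: g_def mult.commute add.commute)
    show "continuous_on UNIV g"
    proof (rule continuous_on_sequentiallyI)
      fix X :: "nat \<Rightarrow> 'a" and x assume X: "X \<longlonglongrightarrow> x"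
      have "(\<lambda>n. LINT z|lborel. f z * \<kappa> (z - X n)) \<longlonglongrightarrow> (LINT z|lborel. f z * \<kappa> (z - x))"
      proof (rule integral_dominated_convergence)
        show "integrable lborel (\<lambda>z. C * f z)" using f by simp
        show "AE z in lborel. norm (f z * \<kappa> (z - X n)) \<le> C * f z" for n
        proof (intro AE_I2)
          fix z
          have "f z * \<kappa> (z - X n) \<le> f z * C" by (intro mult_left_mono \<kappa>(2) f01(1))
          then show "norm (f z * \<kappa> (z - X n)) \<le> C * f z"
            using f01(1)[of z] \<kappa>(1)[of "z - X n"] by (simp add: mult.commute)
        qed
        have "(\<lambda>n. \<kappa> (z - X n)) \<longlonglongrightarrow> \<kappa> (z - x)" for z
          by (rule continuous_on_tendsto_compose[OF c]) (auto intro!: tendsto_intros X)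
        then show "AE z in lborel. (\<lambda>n. f z * \<kappa> (z - X n)) \<longlonglongrightarrow> f z * \<kappa> (z - x)"
          by (intro AE_I2 tendsto_intros)
      qed simp_all
      then show "(\<lambda>n. g (X n)) \<longlonglongrightarrow> g x" unfolding g' .
    qed
    show "(\<integral>\<^sup>+x. w x * ennreal \<bar>g x\<bar> \<partial>lborel) \<le> A"
      if [measurable]: "w \<in> borel_measurable borel"
        and le: "\<And>y. norm y < r \<Longrightarrow> (\<integral>\<^sup>+x. w x * ennreal \<bar>f (x + y)\<bar> \<partial>lborel) \<le> A" for w A
      unfolding g_def by (rule averaged_integral_le) (use \<kappa> le in simp_all)
    show "shift_diff g v \<le> shift_diff f v" for v
    proof -
      have "g (x + v) - g x = (LINT y|lborel. \<kappa> y * (f (x + v + y) - f (x + y)))" for x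
        unfolding g_def right_diff_distrib by (rule Bochner_Integration.integral_diff[symmetric]) (rule int)+
      then have "shift_diff g v
          = (\<integral>\<^sup>+x. 1 * ennreal \<bar>LINT y|lborel. \<kappa> y * (f (x + v + y) - f (x + y))\<bar> \<partial>lborel)"
        by (simp add: shift_diff_def)
      also have "\<dots> \<le> shift_diff f v"
      proof (rule averaged_integral_le)
        show "(\<integral>\<^sup>+x. 1 * ennreal \<bar>f (x + v + y) - f (x + y)\<bar> \<partial>lborel) \<le> shift_diff f v" for y
          using nn_integral_lborel_translate[of "\<lambda>x. ennreal \<bar>f (x + v) - f x\<bar>" y]
          by (simp add: shift_diff_def add_ac)
      qed (use \<kappa> in simp_all)
      finally show ?thesis .
    qed
    show "(\<integral>\<^sup>+x. ennreal \<bar>g x - f x\<bar> \<partial>lborel) \<le> A" if le: "\<And>y. norm y < r \<Longrightarrow> shift_diff f y \<le> A" for A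
    proof -
      have "g x - f x = (LINT y|lborel. \<kappa> y * (f (x + y) - f x))" for x
      proof -
        have "(LINT y|lborel. \<kappa> y * (f (x + y) - f x)) = g x - (LINT y|lborel. \<kappa> y * f x)"
          unfolding g_def right_diff_distrib using \<kappa>(4) by (intro Bochner_Integration.integral_diff int) simp
        then show ?thesis using int1 by simp
      qed
      then have "(\<integral>\<^sup>+x. ennreal \<bar>g x - f x\<bar> \<partial>lborel)
          = (\<integral>\<^sup>+x. 1 * ennreal \<bar>LINT y|lborel. \<kappa> y * (f (x + y) - f x)\<bar> \<partial>lborel)"
        by simp
      also have "\<dots> \<le> A"
        by (rule averaged_integral_le) (use \<kappa> le in \<open>simp_all add: shift_diff_def\<close>)
      finally show ?thesis .
    qed
  qed
qed

text \<open>The weight has polynomial growth, so a shift of length at most \<open>1\<close> changes it by a bounded factor,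
  up to an additive constant near the origin.\<close>

lemma weight_translate_le:
  assumes \<alpha>: "1 \<le> \<alpha>" and y: "norm y \<le> 1"
  shows "weight \<alpha> (x + y) \<le> 2 powr (\<alpha> / 2) * (sqrt (\<alpha> - 1) + weight \<alpha> x)"
proof -
  have "norm (x + y) powr (\<alpha> / 2) \<le> (2 * max 1 (norm x)) powr (\<alpha> / 2)"
    using \<alpha> y norm_triangle_ineq[of x y] by (intro powr_mono2) auto
  also have "\<dots> = 2 powr (\<alpha> / 2) * max 1 (norm x) powr (\<alpha> / 2)"
    by (simp add: powr_mult)
  also have "\<dots> \<le> 2 powr (\<alpha> / 2) * (1 + norm x powr (\<alpha> / 2))"
    by (intro mult_left_mono) (auto simp: max_def)
  finally have "sqrt (\<alpha> - 1) * norm (x + y) powr (\<alpha> / 2)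
      \<le> sqrt (\<alpha> - 1) * (2 powr (\<alpha> / 2) * (1 + norm x powr (\<alpha> / 2)))"
    using \<alpha> by (intro mult_left_mono) auto
  then show ?thesis by (simp add: weight_def algebra_simps)
qed

text \<open>The witness for the capacity is \<open>min 1 (2 * g)\<close> with \<open>g\<close> a mollification of \<open>f\<close> at scale \<open>r\<close>: it is \<open>1\<close> on the
  open set \<open>{g > 1/2}\<close>, and truncation at most doubles increments. The constant does not depend on
  \<open>r\<close>.\<close>

lemma ex_continuous_capacity_bound:
  fixes f :: "real^'d::finite \<Rightarrow> real"
  assumes \<alpha>: "1 \<le> \<alpha>" and f: "integrable lborel f" and f01: "\<And>x. 0 \<le> f x" "\<And>x. f x \<le> 1"
    and fin: "variation_H \<alpha> f < \<infinity>" and r: "0 < r" "r \<le> 1"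
  obtains g where "continuous_on UNIV g" "integrable lborel g"
    "(\<integral>\<^sup>+x. ennreal \<bar>g x - f x\<bar> \<partial>lborel) \<le> ennreal r * variation_H \<alpha> f"
    "cap_H \<alpha> {x. 1/2 < g x}
      \<le> ennreal (2 + 4 * CARD('d) + 4 * CARD('d) * (2 powr (\<alpha> / 2) * (sqrt (\<alpha> - 1) + CARD('d)))) * BV_H_norm \<alpha> f"
proof (rule ex_mollification[OF f f01 r(1)])
  let ?V = "variation_H \<alpha> f" and ?d = "of_nat CARD('d) :: ennreal"
  let ?N = "\<integral>\<^sup>+x. ennreal \<bar>f x\<bar> \<partial>lborel"
  fix g
  assume g: "continuous_on UNIV g" "\<And>x. 0 \<le> g x"
    "\<And>w A. w \<in> borel_measurable borel \<Longrightarrow>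
      (\<And>y. norm y < r \<Longrightarrow> (\<integral>\<^sup>+x. w x * ennreal \<bar>f (x + y)\<bar> \<partial>lborel) \<le> A) \<Longrightarrow>
      (\<integral>\<^sup>+x. w x * ennreal \<bar>g x\<bar> \<partial>lborel) \<le> A"
    "\<And>v. shift_diff g v \<le> shift_diff f v"
    "\<And>A. (\<And>y. norm y < r \<Longrightarrow> shift_diff f y \<le> A) \<Longrightarrow> (\<integral>\<^sup>+x. ennreal \<bar>g x - f x\<bar> \<partial>lborel) \<le> A"
  have [measurable]: "f \<in> borel_measurable borel" using borel_measurable_integrable[OF f] by simp
  have [measurable]: "g \<in> borel_measurable borel" by (rule borel_measurable_continuous_onI[OF g(1)])
  have Nfin: "?N < \<infinity>" using f by (simp add: integrable_iff_bounded)
  have gN: "(\<integral>\<^sup>+x. ennreal \<bar>g x\<bar> \<partial>lborel) \<le> ?N"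
    using g(3)[of "\<lambda>_. 1" ?N] nn_integral_lborel_translate[of "\<lambda>x. ennreal \<bar>f x\<bar>"] by simp
  have gi: "integrable lborel g"
    using order_le_less_trans[OF gN Nfin] by (simp add: integrable_iff_bounded)
  have gW: "(\<integral>\<^sup>+x. ennreal (weight \<alpha> x) * ennreal \<bar>g x\<bar> \<partial>lborel)
      \<le> ennreal (2 powr (\<alpha> / 2) * (sqrt (\<alpha> - 1) + CARD('d))) * (?N + ?V)"
  proof (rule g(3))
    fix y :: "real^'d" assume y: "norm y < r"
    let ?c = "ennreal (2 powr (\<alpha> / 2))" and ?s = "ennreal (sqrt (\<alpha> - 1))"
    have "(\<integral>\<^sup>+x. ennreal (weight \<alpha> x) * ennreal \<bar>f (x + y)\<bar> \<partial>lborel)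
        = (\<integral>\<^sup>+x. ennreal (weight \<alpha> (x + -y)) * ennreal \<bar>f x\<bar> \<partial>lborel)"
      using nn_integral_lborel_translate[of "\<lambda>x. ennreal (weight \<alpha> (x + -y)) * ennreal \<bar>f x\<bar>" y] by simp
    also have "\<dots> \<le> (\<integral>\<^sup>+x. ?c * (?s * ennreal \<bar>f x\<bar> + ennreal (weight \<alpha> x * \<bar>f x\<bar>)) \<partial>lborel)"
    proof (intro nn_integral_mono)
      fix x
      have "weight \<alpha> (x + -y) * \<bar>f x\<bar> \<le> 2 powr (\<alpha> / 2) * (sqrt (\<alpha> - 1) + weight \<alpha> x) * \<bar>f x\<bar>"
        using y r by (intro mult_right_mono weight_translate_le \<alpha>) auto
      then have "ennreal (weight \<alpha> (x + -y) * \<bar>f x\<bar>)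
          \<le> ennreal (2 powr (\<alpha> / 2) * (sqrt (\<alpha> - 1) * \<bar>f x\<bar> + weight \<alpha> x * \<bar>f x\<bar>))"
        by (intro ennreal_leI) (simp add: algebra_simps)
      then show "ennreal (weight \<alpha> (x + -y)) * ennreal \<bar>f x\<bar> \<le> ?c * (?s * ennreal \<bar>f x\<bar> + ennreal (weight \<alpha> x * \<bar>f x\<bar>))"
        using \<alpha> by (simp add: ennreal_mult weight_nonneg ennreal_plus)
    qed
    also have "\<dots> = ?c * (?s * ?N + (\<integral>\<^sup>+x. ennreal (weight \<alpha> x * \<bar>f x\<bar>) \<partial>lborel))"
      by (simp add: nn_integral_cmult nn_integral_add)
    also have "\<dots> \<le> ?c * (?s * ?N + ?d * ?V)"
      by (intro mult_left_mono add_left_mono integral_weight_le_variation \<alpha> f) auto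
    also have "\<dots> \<le> ?c * (?s * ?N + ?d * ?V + (?s * ?V + ?d * ?N))"
      by (intro mult_left_mono) auto
    also have "\<dots> = ?c * ((?s + ?d) * (?N + ?V))"
      by (simp add: algebra_simps)
    also have "\<dots> = ennreal (2 powr (\<alpha> / 2) * (sqrt (\<alpha> - 1) + CARD('d))) * (?N + ?V)"
      using \<alpha> by (simp add: ennreal_mult ennreal_plus ennreal_of_nat_eq_real_of_nat mult.assoc)
    finally show "(\<integral>\<^sup>+x. ennreal (weight \<alpha> x) * ennreal \<bar>f (x + y)\<bar> \<partial>lborel)
        \<le> ennreal (2 powr (\<alpha> / 2) * (sqrt (\<alpha> - 1) + CARD('d))) * (?N + ?V)" .
  qed simp
  \<comment> \<open>The factor \<open>2\<close> makes \<open>h\<close> equal to \<open>1\<close> where \<open>g\<close> exceeds \<open>1/2\<close>.\<close>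
  define h where "h x = min 1 (2 * g x)" for x
  have [measurable]: "h \<in> borel_measurable borel" unfolding h_def by measurable
  have h: "0 \<le> h x" "h x \<le> 1" "\<bar>h x\<bar> \<le> 2 * \<bar>g x\<bar>" for x using g(2)[of x] by (auto simp: h_def)
  have hN: "(\<integral>\<^sup>+x. ennreal \<bar>h x\<bar> \<partial>lborel) \<le> 2 * ?N"
  proof -
    have "(\<integral>\<^sup>+x. ennreal \<bar>h x\<bar> \<partial>lborel) \<le> (\<integral>\<^sup>+x. 2 * ennreal \<bar>g x\<bar> \<partial>lborel)"
      using ennreal_leI[OF h(3)] by (intro nn_integral_mono) (simp add: ennreal_mult)
    also have "\<dots> \<le> 2 * ?N" by (simp add: nn_integral_cmult mult_left_mono gN)
    finally show ?thesis .
  qed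
  have hi: "integrable lborel h"
    by (rule Bochner_Integration.integrable_bound[of lborel "\<lambda>x. 2 * g x"]) (use gi h(3) g(2) in auto)
  have hs: "shift_diff h v \<le> 2 * shift_diff f v" for v
  proof -
    have "\<bar>h (x + v) - h x\<bar> \<le> 2 * \<bar>g (x + v) - g x\<bar>" for x
      by (simp add: h_def min_def abs_if)
    then have "shift_diff h v \<le> (\<integral>\<^sup>+x. 2 * ennreal \<bar>g (x + v) - g x\<bar> \<partial>lborel)"
      unfolding shift_diff_def using ennreal_leI by (intro nn_integral_mono) (fastforce simp: ennreal_mult)
    also have "\<dots> = 2 * shift_diff g v" by (simp add: nn_integral_cmult shift_diff_def)
    also have "\<dots> \<le> 2 * shift_diff f v" by (intro mult_left_mono g(4)) auto
    finally show ?thesis .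
  qed
  have hL: "liminf (\<lambda>n. ennreal (Suc n) * shift_diff h ((1 / Suc n) *\<^sub>R axis i 1)) \<le> 2 * ?V" for i
  proof -
    have "liminf (\<lambda>n. ennreal (Suc n) * shift_diff h ((1 / Suc n) *\<^sub>R axis i 1)) \<le> liminf (\<lambda>n. 2 * ?V)"
    proof (intro Liminf_mono always_eventually allI)
      fix n
      have "ennreal (Suc n) * shift_diff h ((1 / Suc n) *\<^sub>R axis i 1)
          \<le> ennreal (Suc n) * (2 * shift_diff f ((1 / Suc n) *\<^sub>R axis i 1))"
        by (intro mult_left_mono hs) auto
      also have "\<dots> = 2 * (ennreal (Suc n) * shift_diff f ((1 / Suc n) *\<^sub>R axis i 1))"
        by (simp only: mult_ac)
      also have "\<dots> \<le> 2 * ?V"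
        by (intro mult_left_mono scaled_shift_diff_le_variation f) auto
      finally show "ennreal (Suc n) * shift_diff h ((1 / Suc n) *\<^sub>R axis i 1) \<le> 2 * ?V" .
    qed
    then show ?thesis by (simp add: Liminf_const)
  qed
  let ?K = "2 powr (\<alpha> / 2) * (sqrt (\<alpha> - 1) + CARD('d))"
  have hW: "(\<integral>\<^sup>+x. ennreal (weight \<alpha> x * \<bar>h x\<bar>) \<partial>lborel) \<le> 2 * (ennreal ?K * (?N + ?V))"
  proof -
    have "(\<integral>\<^sup>+x. ennreal (weight \<alpha> x * \<bar>h x\<bar>) \<partial>lborel)
        \<le> (\<integral>\<^sup>+x. 2 * (ennreal (weight \<alpha> x) * ennreal \<bar>g x\<bar>) \<partial>lborel)"
    proof (intro nn_integral_mono)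
      fix x
      have "ennreal (weight \<alpha> x * \<bar>h x\<bar>) \<le> ennreal (weight \<alpha> x * (2 * \<bar>g x\<bar>))"
        by (intro ennreal_leI mult_left_mono h(3) weight_nonneg \<alpha>)
      then show "ennreal (weight \<alpha> x * \<bar>h x\<bar>) \<le> 2 * (ennreal (weight \<alpha> x) * ennreal \<bar>g x\<bar>)"
        using weight_nonneg[OF \<alpha>, of x] by (simp add: ennreal_mult mult_ac)
    qed
    also have "\<dots> \<le> 2 * (ennreal ?K * (?N + ?V))"
      by (simp add: nn_integral_cmult mult_left_mono gW)
    finally show ?thesis .
  qed
  have "variation_H \<alpha> h \<le> 2 * (\<Sum>i\<in>(UNIV::'d set). 2 * ?V) + 2 * ?d * (2 * (ennreal ?K * (?N + ?V)))"
    by (rule order_trans[OF variation_le_liminf_shift_diff[OF \<alpha> hi]])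
       (intro add_mono mult_left_mono sum_mono hL hW zero_le)
  \<comment> \<open>The terms added below complete the bound to a multiple of \<open>?N + ?V\<close>.\<close>
  then have "BV_H_norm \<alpha> h \<le> 2 * ?N + (2 * (\<Sum>i\<in>(UNIV::'d set). 2 * ?V) + 2 * ?d * (2 * (ennreal ?K * (?N + ?V))))"
    unfolding BV_H_norm_def using hN by (intro add_mono) auto
  also have "\<dots> \<le> \<dots> + (2 * ?V + 4 * ?d * ?N)" by simp
  also have "\<dots> = (2 + 4 * ?d + 4 * ?d * ennreal ?K) * (?N + ?V)"
    by (simp add: algebra_simps)
  also have "2 + 4 * ?d + 4 * ?d * ennreal ?K = ennreal (2 + 4 * CARD('d) + 4 * CARD('d) * ?K)"
    using \<alpha> by (simp add: ennreal_mult ennreal_plus ennreal_of_nat_eq_real_of_nat)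
  finally have hB: "BV_H_norm \<alpha> h \<le> ennreal (2 + 4 * CARD('d) + 4 * CARD('d) * ?K) * BV_H_norm \<alpha> f"
    by (simp add: BV_H_norm_def)
  have "BV_H_norm \<alpha> f < \<infinity>" using fin Nfin by (simp add: BV_H_norm_def)
  then have "ennreal (2 + 4 * CARD('d) + 4 * CARD('d) * ?K) * BV_H_norm \<alpha> f < \<infinity>"
    by (simp add: ennreal_mult_less_top)
  moreover have "variation_H \<alpha> h \<le> BV_H_norm \<alpha> h" by (simp add: BV_H_norm_def)
  ultimately have "variation_H \<alpha> h < \<infinity>"
    using hB by (meson order_le_less_trans)
  moreover have "open {x. 1/2 < g x}"
    by (rule open_Collect_less) (use g(1) in \<open>auto intro: continuous_intros\<close>)
  moreover have "h x = 1" if "1/2 < g x" for x using that by (simp add: h_def)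
  ultimately have "h \<in> admissible_H \<alpha> {x. 1/2 < g x}"
    using hi h(1,2) by (auto simp: admissible_H_def BV_H_def intro!: exI[of _ "{x. 1/2 < g x}"])
  then have cap: "cap_H \<alpha> {x. 1/2 < g x} \<le> BV_H_norm \<alpha> h"
    unfolding cap_H_def by (rule INF_lower)
  have "(\<integral>\<^sup>+x. ennreal \<bar>g x - f x\<bar> \<partial>lborel) \<le> ennreal r * ?V"
  proof (rule g(5))
    fix y :: "real^'d" assume "norm y < r"
    then have "ennreal (norm y) * ?V \<le> ennreal r * ?V" by (intro mult_right_mono ennreal_leI) auto
    then show "shift_diff f y \<le> ennreal r * ?V"
      using shift_diff_le_variation[OF f] order_trans by blast
  qed
  then show ?thesis
    by (rule that[OF g(1) gi _ order_trans[OF cap hB]])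
qed

section \<open>The equivalences\<close>

lemma isoperimetric_if_sobolev:
  fixes \<mu> :: "(real^'d::finite) measure"
  assumes mu: "sets \<mu> = sets borel" and "0 < c"
    and sob: "\<And>f. f \<in> BV_H \<alpha> \<Longrightarrow>
      ennpowr (\<integral>\<^sup>+x. ennreal (\<bar>f x\<bar> powr p) \<partial>\<mu>) (1 / p) \<le> ennreal c * BV_H_norm \<alpha> f"
    and B: "B \<in> sets borel"
  shows "ennpowr (emeasure \<mu> B) (1 / p) \<le> ennreal c * (emeasure lborel B + perimeter_H \<alpha> B)"
proof (cases "emeasure lborel B + perimeter_H \<alpha> B = \<infinity>")
  case True
  then show ?thesis unfolding True using \<open>0 < c\<close> by (simp add: ennreal_mult_top)
next
  case False
  then have "emeasure lborel B < \<infinity>" "variation_H \<alpha> (indicator B) < \<infinity>"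
    by (auto simp: perimeter_H_eq less_top)
  then have "indicator B \<in> BV_H \<alpha>"
    using B by (simp add: BV_H_def)
  from sob[OF this]
  have "ennpowr (\<integral>\<^sup>+x. ennreal (\<bar>indicator B x\<bar> powr p) \<partial>\<mu>) (1 / p)
      \<le> ennreal c * BV_H_norm \<alpha> (indicator B)" .
  moreover have "(\<integral>\<^sup>+x. ennreal (\<bar>indicator B x\<bar> powr p) \<partial>\<mu>) = (\<integral>\<^sup>+x. indicator B x \<partial>\<mu>)"
    by (intro nn_integral_cong) (auto simp: indicator_def)
  moreover have "(\<integral>\<^sup>+x. ennreal \<bar>indicator B x\<bar> \<partial>lborel) = (\<integral>\<^sup>+x. indicator B x \<partial>lborel)"
    by (intro nn_integral_cong) (auto simp: indicator_def)
  ultimately show ?thesis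
    using mu B by (simp add: BV_H_norm_def perimeter_H_eq)
qed

text \<open>An admissible function is at least the indicator of \<open>B\<close>.\<close>

lemma capacitary_if_sobolev:
  fixes \<mu> :: "(real^'d::finite) measure"
  assumes mu: "sets \<mu> = sets borel" and "0 < c" "0 \<le> p"
    and sob: "\<And>f. f \<in> BV_H \<alpha> \<Longrightarrow>
      ennpowr (\<integral>\<^sup>+x. ennreal (\<bar>f x\<bar> powr p) \<partial>\<mu>) (1 / p) \<le> ennreal c * BV_H_norm \<alpha> f"
    and B: "B \<in> sets borel"
  shows "ennpowr (emeasure \<mu> B) (1 / p) \<le> ennreal c * cap_H \<alpha> B"
proof -
  let ?x = "ennpowr (emeasure \<mu> B) (1 / p)"
  have "?x / ennreal c \<le> cap_H \<alpha> B"
    unfolding cap_H_def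
  proof (rule INF_greatest)
    fix f assume f: "f \<in> admissible_H \<alpha> B"
    have "emeasure \<mu> B = (\<integral>\<^sup>+x. indicator B x \<partial>\<mu>)" using B mu by simp
    also have "\<dots> \<le> (\<integral>\<^sup>+x. ennreal (\<bar>f x\<bar> powr p) \<partial>\<mu>)"
    proof (intro nn_integral_mono)
      show "indicator B x \<le> ennreal (\<bar>f x\<bar> powr p)" for x
        using f by (cases "x \<in> B") (auto simp: admissible_H_def)
    qed
    finally have "?x \<le> ennpowr (\<integral>\<^sup>+x. ennreal (\<bar>f x\<bar> powr p) \<partial>\<mu>) (1 / p)"
      using \<open>0 \<le> p\<close> by (intro ennpowr_mono) auto
    also have "\<dots> \<le> ennreal c * BV_H_norm \<alpha> f"
      using f by (intro sob) (simp add: admissible_H_def)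
    finally show "?x / ennreal c \<le> BV_H_norm \<alpha> f"
      using \<open>0 < c\<close> by (intro divide_le_posI_ennreal) auto
  qed
  then have "ennreal c * (?x / ennreal c) \<le> ennreal c * cap_H \<alpha> B"
    by (rule mult_left_mono) simp
  moreover have "ennreal c * (?x / ennreal c) = ?x"
    using \<open>0 < c\<close> by (simp add: ennreal_times_divide mult_divide_eq_ennreal mult.commute[of "ennreal c"])
  ultimately show ?thesis by simp
qed

lemma sobolev_if_isoperimetric:
  fixes \<mu> :: "(real^'d::finite) measure"
  assumes mu: "radon_measure \<mu>" and \<alpha>: "1 \<le> \<alpha>" and p: "1 \<le> p" and "0 < c"
    and iso: "\<And>B. B \<in> sets borel \<Longrightarrow>
      ennpowr (emeasure \<mu> B) (1 / p) \<le> ennreal c * (emeasure lborel B + perimeter_H \<alpha> B)"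
    and f: "f \<in> BV_H \<alpha>"
  shows "ennpowr (\<integral>\<^sup>+x. ennreal (\<bar>f x\<bar> powr p) \<partial>\<mu>) (1 / p)
    \<le> ennreal (2 * c * (1 + 2 * CARD('d) + 2 * CARD('d) * CARD('d))) * BV_H_norm \<alpha> f"
proof -
  let ?C = "of_nat (1 + 2 * CARD('d) + 2 * CARD('d) * CARD('d)) :: ennreal"
  have fi: "integrable lborel f" using f by (simp add: BV_H_def)
  have [measurable]: "f \<in> borel_measurable borel" using borel_measurable_integrable[OF fi] by simp
  have sets: "sets \<mu> = sets borel" and sp: "space \<mu> = UNIV"
    using mu sets_eq_imp_space_eq[of \<mu> borel] by (auto simp: radon_measure_def)
  obtain h where h: "h \<in> borel_measurable borel"
    "\<And>t. 0 < t \<Longrightarrow> emeasure lborel (superlevel f t) + perimeter_H \<alpha> (superlevel f t) \<le> h t"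
    "(\<integral>\<^sup>+t\<in>{0<..}. h t \<partial>lborel) \<le> ?C * BV_H_norm \<alpha> f"
    using coarea_inequality[OF \<alpha> fi] by blast
  have "(\<lambda>x. \<bar>f x\<bar>) \<in> borel_measurable \<mu>"
    unfolding measurable_cong_sets[OF sets refl] by measurable
  then have "ennpowr (\<integral>\<^sup>+x. ennreal (\<bar>f x\<bar> powr p) \<partial>\<mu>) (1 / p)
      \<le> 2 * (\<integral>\<^sup>+t\<in>{0<..}. ennpowr (emeasure \<mu> {x \<in> space \<mu>. t < \<bar>f x\<bar>}) (1 / p) \<partial>lborel)"
    using p by (intro Lp_le_integral_distribution sigma_finite_radon_measure mu) auto
  also have "\<dots> = 2 * (\<integral>\<^sup>+t\<in>{0<..}. ennpowr (emeasure \<mu> (superlevel f t)) (1 / p) \<partial>lborel)"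
    by (simp add: superlevel_def sp)
  also have "\<dots> \<le> 2 * (\<integral>\<^sup>+t. ennreal c * (h t * indicator {0<..} t) \<partial>lborel)"
  proof (intro mult_left_mono nn_integral_mono)
    fix t :: real
    have "ennpowr (emeasure \<mu> (superlevel f t)) (1 / p) \<le> ennreal c * h t" if "0 < t"
      by (rule order_trans[OF iso[OF superlevel_sets] mult_left_mono[OF h(2)[OF that]]]) auto
    then show "ennpowr (emeasure \<mu> (superlevel f t)) (1 / p) * indicator {0<..} t
        \<le> ennreal c * (h t * indicator {0<..} t)"
      by (auto simp: indicator_def)
  qed simp
  also have "\<dots> = 2 * (ennreal c * (\<integral>\<^sup>+t\<in>{0<..}. h t \<partial>lborel))"
    using h(1) by (subst nn_integral_cmult) auto
  also have "\<dots> \<le> 2 * (ennreal c * (?C * BV_H_norm \<alpha> f))"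
    by (intro mult_left_mono h(3)) auto
  also have "\<dots> = (2 * ennreal c * ?C) * BV_H_norm \<alpha> f"
    by (simp only: mult.assoc)
  also have "2 * ennreal c * ?C = ennreal (2 * c * (1 + 2 * CARD('d) + 2 * CARD('d) * CARD('d)))"
    using \<open>0 < c\<close> by (simp add: ennreal_mult ennreal_plus ennreal_of_nat_eq_real_of_nat mult_ac)
  finally show ?thesis .
qed

text \<open>Apply the capacitary inequality to the open sets \<open>{g\<^sub>n > 1/2}\<close>, where the \<open>g\<^sub>n\<close> are mollifications of the
  indicator of \<open>B\<close> at scale \<open>1 / Suc n\<close>. Almost every point of \<open>B\<close> lies in all but finitely many members of
  a subsequence, and by absolute continuity this exception is also \<open>\<mu>\<close>-null.\<close>

lemma isoperimetric_if_capacitary: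
  fixes \<mu> :: "(real^'d::finite) measure"
  assumes mu: "radon_measure \<mu>" and ac: "absolutely_continuous lborel \<mu>"
    and \<alpha>: "1 \<le> \<alpha>" and p: "1 \<le> p" and c: "0 < c"
    and cap: "\<And>B. B \<in> sets borel \<Longrightarrow> ennpowr (emeasure \<mu> B) (1 / p) \<le> ennreal c * cap_H \<alpha> B"
    and B[measurable]: "B \<in> sets borel"
  shows "ennpowr (emeasure \<mu> B) (1 / p)
    \<le> ennreal (c * (2 + 4 * CARD('d) + 4 * CARD('d) * (2 powr (\<alpha> / 2) * (sqrt (\<alpha> - 1) + CARD('d)))))
      * (emeasure lborel B + perimeter_H \<alpha> B)"
    (is "_ \<le> ennreal (c * ?C) * _")
proof (cases "emeasure lborel B + perimeter_H \<alpha> B = \<infinity>")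
  case True
  have "0 < ?C" using \<alpha> by (intro add_pos_nonneg) auto
  then have "ennreal (c * ?C) \<noteq> 0" using c by simp
  then show ?thesis unfolding True by (simp only: ennreal_mult_top infinity_ennreal_def if_False top_greatest)
next
  case False
  let ?f = "indicator B :: real^'d \<Rightarrow> real"
  let ?V = "variation_H \<alpha> ?f"
  have fin: "emeasure lborel B < \<infinity>" "?V < \<infinity>"
    using False by (auto simp: perimeter_H_eq less_top)
  have f: "integrable lborel ?f" using fin by simp
  have N: "BV_H_norm \<alpha> ?f = emeasure lborel B + perimeter_H \<alpha> B"
  proof -
    have "(\<integral>\<^sup>+x. ennreal \<bar>?f x\<bar> \<partial>lborel) = (\<integral>\<^sup>+x. indicator B x \<partial>lborel)"
      by (intro nn_integral_cong) (auto simp: indicator_def)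
    then show ?thesis by (simp add: BV_H_norm_def perimeter_H_eq)
  qed
  have sets: "sets \<mu> = sets borel" using mu by (simp add: radon_measure_def)
  have approx: "\<exists>g. continuous_on UNIV g \<and> integrable lborel g
      \<and> (\<integral>\<^sup>+x. ennreal \<bar>g x - ?f x\<bar> \<partial>lborel) \<le> ennreal (1 / Suc n) * ?V
      \<and> cap_H \<alpha> {x. 1/2 < g x} \<le> ennreal ?C * BV_H_norm \<alpha> ?f" for n
  proof (rule ex_continuous_capacity_bound[OF \<alpha> f _ _ fin(2)])
    show "0 < 1 / real (Suc n)" "1 / real (Suc n) \<le> 1" by auto
    fix g :: "real^'d \<Rightarrow> real"
    assume "continuous_on UNIV g" "integrable lborel g"
      "(\<integral>\<^sup>+x. ennreal \<bar>g x - ?f x\<bar> \<partial>lborel) \<le> ennreal (1 / Suc n) * ?V"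
      "cap_H \<alpha> {x. 1/2 < g x} \<le> ennreal ?C * BV_H_norm \<alpha> ?f"
    then show ?thesis by blast
  qed simp_all
  from choice[OF allI[OF approx]]
  obtain g where g: "\<forall>n. continuous_on UNIV (g n) \<and> integrable lborel (g n)
      \<and> (\<integral>\<^sup>+x. ennreal \<bar>g n x - ?f x\<bar> \<partial>lborel) \<le> ennreal (1 / Suc n) * ?V
      \<and> cap_H \<alpha> {x. 1/2 < g n x} \<le> ennreal ?C * BV_H_norm \<alpha> ?f"
    by (rule exE)
  have gc: "continuous_on UNIV (g n)" and gi: "integrable lborel (g n)"
    and gf: "(\<integral>\<^sup>+x. ennreal \<bar>g n x - ?f x\<bar> \<partial>lborel) \<le> ennreal (1 / Suc n) * ?V"
    and gcap: "cap_H \<alpha> {x. 1/2 < g n x} \<le> ennreal ?C * BV_H_norm \<alpha> ?f" for n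
    using spec[OF g, of n] by simp_all
  define U where "U n = {x. 1/2 < g n x}" for n
  have U: "U n \<in> sets borel" for n
    unfolding U_def using gc by (intro borel_open open_Collect_less) (auto intro: continuous_intros)
  define K where "K = c * (?C * enn2real (BV_H_norm \<alpha> ?f))"
  have "0 \<le> ?C" using \<alpha> by (intro add_nonneg_nonneg mult_nonneg_nonneg) auto
  then have "0 \<le> K" using c by (simp add: K_def)
  have K: "ennreal K = ennreal (c * ?C) * BV_H_norm \<alpha> ?f"
  proof -
    have "BV_H_norm \<alpha> ?f = ennreal (enn2real (BV_H_norm \<alpha> ?f))" using False N by (simp add: less_top)
    then show ?thesis
      using c \<open>0 \<le> ?C\<close> unfolding K_def by (simp add: ennreal_mult mult.assoc)
  qed
  have mU: "emeasure \<mu> (U n) \<le> ennreal (K powr p)" for n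
  proof -
    have "ennpowr (emeasure \<mu> (U n)) (1 / p) \<le> ennreal c * cap_H \<alpha> (U n)" by (rule cap[OF U])
    also have "\<dots> \<le> ennreal c * (ennreal ?C * BV_H_norm \<alpha> ?f)"
      unfolding U_def by (intro mult_left_mono gcap) auto
    also have "\<dots> = ennreal K" unfolding K using c \<open>0 \<le> ?C\<close> by (simp only: ennreal_mult mult.assoc less_imp_le)
    finally show ?thesis using p \<open>0 \<le> K\<close> by (simp add: ennpowr_inverse_le_iff)
  qed
  have int: "integrable lborel (\<lambda>x. g n x - ?f x)" for n using gi f by (intro Bochner_Integration.integrable_diff)
  have "(\<lambda>n. LINT x|lborel. norm (g n x - ?f x)) \<longlonglongrightarrow> 0"
  proof (rule tendsto_sandwich[OF _ _ tendsto_const])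
    show "\<forall>\<^sub>F n in sequentially. 0 \<le> (LINT x|lborel. norm (g n x - ?f x))" by simp
    show "\<forall>\<^sub>F n in sequentially. (LINT x|lborel. norm (g n x - ?f x)) \<le> inverse (real (Suc n)) * enn2real ?V"
    proof (intro always_eventually allI)
      fix n
      have "ennreal (LINT x|lborel. norm (g n x - ?f x)) = (\<integral>\<^sup>+x. ennreal \<bar>g n x - ?f x\<bar> \<partial>lborel)"
        using int[of n] by (subst nn_integral_eq_integral[symmetric]) (auto intro: integrable_norm)
      also have "\<dots> \<le> ennreal (1 / Suc n) * ennreal (enn2real ?V)" using gf[of n] fin(2) by simp
      also have "\<dots> = ennreal (inverse (real (Suc n)) * enn2real ?V)"
        by (simp add: inverse_eq_divide flip: ennreal_mult)
      finally show "(LINT x|lborel. norm (g n x - ?f x)) \<le> inverse (real (Suc n)) * enn2real ?V"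
        by (subst (asm) ennreal_le_iff) auto
    qed
    show "(\<lambda>n. inverse (real (Suc n)) * enn2real ?V) \<longlonglongrightarrow> 0"
      using tendsto_mult_right[OF LIMSEQ_inverse_real_of_nat, of "enn2real ?V"] by simp
  qed
  from tendsto_L1_AE_subseq[OF int this] obtain r where
    "AE x in lborel. (\<lambda>n. g (r n) x - ?f x) \<longlonglongrightarrow> 0" by blast
  then have ae: "AE x in \<mu>. (\<lambda>n. g (r n) x - ?f x) \<longlonglongrightarrow> 0"
    using absolutely_continuous_AE[OF _ ac] sets by simp
  have "emeasure \<mu> B = (\<integral>\<^sup>+x. indicator B x \<partial>\<mu>)" using B sets by simp
  also have "\<dots> \<le> (\<integral>\<^sup>+x. liminf (\<lambda>n. indicator (U (r n)) x) \<partial>\<mu>)"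
  proof (rule nn_integral_mono_AE)
    show "AE x in \<mu>. indicator B x \<le> (liminf (\<lambda>n. indicator (U (r n)) x) :: ennreal)"
      using ae
    proof eventually_elim
      case (elim x)
      show ?case
      proof (cases "x \<in> B")
        case True
        have "\<forall>\<^sub>F n in sequentially. - (1/2) < g (r n) x - ?f x"
          by (rule order_tendstoD(1)[OF elim]) simp
        then have "\<forall>\<^sub>F n in sequentially. (1::ennreal) \<le> indicator (U (r n)) x"
          by eventually_elim (use True in \<open>simp add: U_def\<close>)
        then show ?thesis using True by (simp add: Liminf_bounded)
      qed simp
    qed
  qed
  also have "\<dots> \<le> liminf (\<lambda>n. \<integral>\<^sup>+x. indicator (U (r n)) x \<partial>\<mu>)"
    using U sets by (intro nn_integral_liminf) simp
  also have "\<dots> = liminf (\<lambda>n. emeasure \<mu> (U (r n)))"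
    using U sets by simp
  also have "\<dots> \<le> liminf (\<lambda>n. ennreal (K powr p))"
    by (intro Liminf_mono always_eventually allI mU)
  finally have "emeasure \<mu> B \<le> ennreal (K powr p)" by (simp add: Liminf_const)
  then have "ennpowr (emeasure \<mu> B) (1 / p) \<le> ennreal K"
    using p \<open>0 \<le> K\<close> by (simp add: ennpowr_inverse_le_iff)
  then show ?thesis unfolding K N .
qed

theorem theorem2p9:
  fixes \<mu> :: "(real^'d::finite) measure" and \<alpha> p :: real
  assumes "2 \<le> CARD('d)" and "1 \<le> \<alpha>" and "1 \<le> p"
    and "radon_measure \<mu>" and "absolutely_continuous lborel \<mu>"
  shows
    "((\<exists>c>0. \<forall>f\<in>BV_H \<alpha>.
        ennpowr (\<integral>\<^sup>+x. ennreal (\<bar>f x\<bar> powr p) \<partial>\<mu>) (1 / p)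
          \<le> ennreal c * ((\<integral>\<^sup>+x. ennreal \<bar>f x\<bar> \<partial>lborel) + variation_H \<alpha> f))
      \<longleftrightarrow>
      (\<exists>c>0. \<forall>B\<in>sets borel.
        ennpowr (emeasure \<mu> B) (1 / p) \<le> ennreal c * (emeasure lborel B + perimeter_H \<alpha> B)))
     \<and>
     ((\<exists>c>0. \<forall>B\<in>sets borel.
        ennpowr (emeasure \<mu> B) (1 / p) \<le> ennreal c * (emeasure lborel B + perimeter_H \<alpha> B))
      \<longleftrightarrow>
      (\<exists>c>0. \<forall>B\<in>sets borel.
        ennpowr (emeasure \<mu> B) (1 / p) \<le> ennreal c * cap_H \<alpha> B))"
  (is "(?sob \<longleftrightarrow> ?iso) \<and> (?iso \<longleftrightarrow> ?cap)")
proof -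
  have sets: "sets \<mu> = sets borel" using assms(4) by (simp add: radon_measure_def)
  have 12: "?iso \<and> ?cap" if ?sob
  proof -
    from that obtain c where c: "c > 0" "\<And>f. f \<in> BV_H \<alpha> \<Longrightarrow>
        ennpowr (\<integral>\<^sup>+x. ennreal (\<bar>f x\<bar> powr p) \<partial>\<mu>) (1 / p) \<le> ennreal c * BV_H_norm \<alpha> f"
      unfolding BV_H_norm_def by blast
    have "0 \<le> p" using assms(3) by simp
    show ?thesis
      using isoperimetric_if_sobolev[OF sets c] capacitary_if_sobolev[OF sets c(1) \<open>0 \<le> p\<close> c(2)] c(1)
      by blast
  qed
  have 3: ?sob if ?iso
  proof -
    from that obtain c where c: "c > 0" "\<And>B. B \<in> sets borel \<Longrightarrow>
        ennpowr (emeasure \<mu> B) (1 / p) \<le> ennreal c * (emeasure lborel B + perimeter_H \<alpha> B)"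
      by blast
    have "0 < 2 * c * (1 + 2 * CARD('d) + 2 * CARD('d) * CARD('d))"
      using c(1) by (simp add: add_pos_nonneg)
    then show ?thesis
      using sobolev_if_isoperimetric[OF assms(4,2,3) c] unfolding BV_H_norm_def by blast
  qed
  have 4: ?iso if ?cap
  proof -
    from that obtain c where c: "c > 0" "\<And>B. B \<in> sets borel \<Longrightarrow>
        ennpowr (emeasure \<mu> B) (1 / p) \<le> ennreal c * cap_H \<alpha> B"
      by blast
    have "0 < c * (2 + 4 * CARD('d) + 4 * CARD('d) * (2 powr (\<alpha> / 2) * (sqrt (\<alpha> - 1) + CARD('d))))"
      using c(1) assms(2) by (intro mult_pos_pos add_pos_nonneg) auto
    then show ?thesis
      using isoperimetric_if_capacitary[OF assms(4,5,2,3) c] by blast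
  qed
  from 12 3 4 show ?thesis by blast
qed

end
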